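(* Let $\star\in\{*,T\}$, let $L(s)=A+sA^\star$ be a regular $\star$-palindromic pencil, where $A\in\mathbb{C}^{n,n}$, and let $(\lambda_1,\dots,\lambda_{n+1})\in\mathcal{K}$. For each $\lambda_j$ define $M_j=L(\lambda_j)^{-1}$, $$C_j=\begin{bmatrix}M_j^\star&0\\ \bar\lambda_j M_j^\star-M_j&-\lambda_jM_j\end{bmatrix},\qquad \Gamma_j=\begin{bmatrix}\sqrt{\frac{1}{1+|\lambda_j|}}\,I_n&0\\0&\sqrt{\frac{|\lambda_j|}{1+|\lambda_j|}}\,I_n\end{bmatrix},$$ $$G_j=\Gamma_j^{-1}\begin{bmatrix}I_n\\ \bar\lambda_jI_n\end{bmatrix}M_j^*M_j\begin{bmatrix}I_n&\lambda_jI_n\end{bmatrix}\Gamma_j^{-1}.$$ Then: 1. When $\star=*$, $$\delta^{\mathrm{pal}_*}(A,A^* )^2\ \ge\ 2\max_{j=1,\dots,n+1}\Big(\min_{t_1,t_2\in\mathbb{R}}\lambda_{\max}(G_j+t_1H_{1j}+t_2H_{2j})\Big)^{-1},$$ where $H_{1j}=\Gamma_j^{-1}(C_j+C_j^* )\Gamma_j^{-1}$ and $H_{2j}=i\,\Gamma_j^{-1}(C_j-C_j^* )\Gamma_j^{-1}$. 2. When $\star=T$, $$\delta^{\mathrm{pal}_T}(A,A^T)^2\ \ge\ 2\max_{j=1,\dots,n+1}\left(\min_{t\in[0,\infty)}\lambda_2\left(\begin{bmatrix}G_j&t\,\overline{S_j}\\ tS_j&G_j\end{bmatrix}\right)\right)^{-1},$$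 where $S_j=\Gamma_j^{-1}(C_j+C_j^T)\Gamma_j^{-1}$.
   Context: $\mathbb{C}^{n,n}$ is the set of complex $n\times n$ matrices and $I_n$ is the identity; $\star=*$ is conjugate transpose, $\star=T$ is transpose, and a bar denotes (entrywise) complex conjugation; the prefactor $i$ in $H_{2j}$ is the imaginary unit. A pencil $L(s)=A+sE$ is regular if $L(\lambda)$ is invertible for some $\lambda\in\mathbb{C}$, and $\star$-palindromic if $E=A^\star$. $\|\cdot\|$ is the spectral norm; $\lambda_{\max}(H)$ and $\lambda_2(H)$ are the largest and second-largest eigenvalues of a Hermitian matrix $H$. The set $$\mathcal{K}=\{(\lambda_1,\dots,\lambda_{n+1})\in\mathbb{C}^{n+1}\;:\;\lambda_i\neq\lambda_j \text{ for } i\neq j,\ L(\lambda_i)\text{ invertible for all } i=1,\dots,n+1\}.$$ The $\star$-palindromic distance to singularity is $$\delta^{\mathrm{pal}_\star}(A,A^\star)=\inf\Big\{\sqrt{\|\Delta_A\|^2+\|\Delta_A^\star\|^2}\;:\;\Delta_A\in\mathbb{C}^{n,n},\ \det\big((A-\Delta_A)+\lambda(A^\star-\Delta_A^\star)\big)=0\text{ for all }\lambda\in\mathbb{C}\Big\}.$$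
   Formalization: For ⋆=T the printed claim is false (n=1, A=1, λ=3−4i): the lower-left block of C_j is taken as λ_j M_j^T − M_j, and the lower-right block of the 4n×4n matrix as the conjugate of G_j. All λ_j are assumed nonzero, so that Γ_j^{-1} exists. *)

theory Defs
  imports "HOL-Analysis.Analysis"
begin

definition smat :: "complex \<Rightarrow> complex^'n^'m \<Rightarrow> complex^'n^'m"  (infixr "*\<^sub>C" 75)
  where "c *\<^sub>C A = map_matrix (\<lambda>x. c * x) A"

definition conj_mat :: "complex^'n^'m \<Rightarrow> complex^'n^'m"
  where "conj_mat A = map_matrix cnj A"

definition ctranspose :: "complex^'n^'m \<Rightarrow> complex^'m^'n"
  where "ctranspose A = transpose (conj_mat A)"

datatype star = Star_CT | Star_T

fun star_mat :: "star \<Rightarrow> complex^'n^'m \<Rightarrow> complex^'m^'n"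
  where
    "star_mat Star_CT A = ctranspose A"
  | "star_mat Star_T A = transpose A"

definition hcat :: "'a^'b^'m \<Rightarrow> 'a^'c^'m \<Rightarrow> 'a^('b + 'c)^'m"
  where "hcat A B = (\<chi> i j. case j of Inl b \<Rightarrow> A $ i $ b | Inr c \<Rightarrow> B $ i $ c)"

definition vcat :: "'a^'b^'m \<Rightarrow> 'a^'b^'k \<Rightarrow> 'a^'b^('m + 'k)"
  where "vcat A B = (\<chi> i. case i of Inl m \<Rightarrow> A $ m | Inr k \<Rightarrow> B $ k)"

definition block_mat ::
  "'a^'b^'m \<Rightarrow> 'a^'c^'m \<Rightarrow> 'a^'b^'k \<Rightarrow> 'a^'c^'k \<Rightarrow> 'a^('b + 'c)^('m + 'k)"
  where "block_mat A B C D = vcat (hcat A B) (hcat C D)"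

definition spectral_norm :: "complex^'n^'m \<Rightarrow> real"
  where "spectral_norm A = onorm (\<lambda>x. A *v x)"

text \<open>The functions below are meant for Hermitian matrices: all eigenvalues are real, and the
  multiplicity of an eigenvalue is the (complex) dimension of its eigenspace.\<close>

definition eigenspace :: "complex^'n^'n \<Rightarrow> real \<Rightarrow> (complex^'n) set"
  where "eigenspace H x = {v. H *v v = complex_of_real x *s v}"

definition eigvals :: "complex^'n^'n \<Rightarrow> real set"
  where "eigvals H = {x. \<exists>v \<in> eigenspace H x. v \<noteq> 0}"

definition lambda_max :: "complex^'n^'n \<Rightarrow> real"
  where "lambda_max H = Max (eigvals H)"

text \<open>Eigenvalues are ordered with multiplicity, so \<open>lambda_2\<close> is equal to \<open>lambda_max\<close>
  exactly when the largest eigenvalue is multiple.\<close>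

definition lambda_2 :: "complex^'n^'n \<Rightarrow> real"
  where "lambda_2 H =
    Max {x \<in> eigvals H. 2 \<le> (\<Sum>y \<in> {y \<in> eigvals H. x \<le> y}. vec.dim (eigenspace H y))}"

definition pencil :: "complex^'n^'n \<Rightarrow> complex^'n^'n \<Rightarrow> complex \<Rightarrow> complex^'n^'n"
  where "pencil A E s = A + s *\<^sub>C E"

definition regular_pencil :: "complex^'n^'n \<Rightarrow> complex^'n^'n \<Rightarrow> bool"
  where "regular_pencil A E \<longleftrightarrow> (\<exists>s. invertible (pencil A E s))"

definition pal_dist :: "star \<Rightarrow> complex^'n^'n \<Rightarrow> real"
  where "pal_dist st A =
    Inf {sqrt ((spectral_norm D)\<^sup>2 + (spectral_norm (star_mat st D))\<^sup>2) | D.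
           \<forall>s. det (pencil (A - D) (star_mat st A - star_mat st D) s) = 0}"

text \<open>The \<open>(n+1)\<close>-tuples are functions on \<open>{1..n+1}\<close>; values outside this range are irrelevant.\<close>

definition \<K> :: "(complex \<Rightarrow> complex^'n^'n) \<Rightarrow> (nat \<Rightarrow> complex) set"
  where "\<K> L = {lam. inj_on lam {1..CARD('n) + 1} \<and>
                     (\<forall>i \<in> {1..CARD('n) + 1}. invertible (L (lam i)))}"

definition M_mat :: "star \<Rightarrow> complex^'n^'n \<Rightarrow> complex \<Rightarrow> complex^'n^'n"
  where "M_mat st A l = matrix_inv (pencil A (star_mat st A) l)"

text \<open>The lower left block is \<open>(l M)\<^sup>\<star> - M\<close>, that is \<open>cnj l M\<^sup>* - M\<close> for the conjugate
  transpose and \<open>l M\<^sup>T - M\<close> for the transpose. With \<open>w = (u, v)\<close> and \<open>x = M (u + l v)\<close> one has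
  \<open>w\<^sup>\<star> C w = x\<^sup>\<star> u - v\<^sup>\<star> x\<close>, which vanishes whenever \<open>u = D x\<close> and \<open>v = D\<^sup>\<star> x\<close>; for the transpose
  this would fail with \<open>cnj l\<close> in place of \<open>l\<close>.\<close>

definition C_mat :: "star \<Rightarrow> complex^'n^'n \<Rightarrow> complex \<Rightarrow> complex^('n::finite + 'n)^('n + 'n)"
  where "C_mat st A l = (let M = M_mat st A l in
    block_mat (star_mat st M) 0 (star_mat st (l *\<^sub>C M) - M) (- (l *\<^sub>C M)))"

definition Gamma_mat :: "complex \<Rightarrow> complex^('n::finite + 'n)^('n + 'n)"
  where "Gamma_mat l =
    block_mat (mat (complex_of_real (sqrt (1 / (1 + cmod l))))) 0
              0 (mat (complex_of_real (sqrt (cmod l / (1 + cmod l)))))"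

definition G_mat :: "star \<Rightarrow> complex^'n^'n \<Rightarrow> complex \<Rightarrow> complex^('n::finite + 'n)^('n + 'n)"
  where "G_mat st A l = (let M = M_mat st A l in
    matrix_inv (Gamma_mat l) ** vcat (mat 1) (mat (cnj l)) ** ctranspose M
      ** M ** hcat (mat 1) (mat l) ** matrix_inv (Gamma_mat l))"

definition H1_mat :: "complex^'n^'n \<Rightarrow> complex \<Rightarrow> complex^('n::finite + 'n)^('n + 'n)"
  where "H1_mat A l = (let C = C_mat Star_CT A l in
    matrix_inv (Gamma_mat l) ** (C + ctranspose C) ** matrix_inv (Gamma_mat l))"

definition H2_mat :: "complex^'n^'n \<Rightarrow> complex \<Rightarrow> complex^('n::finite + 'n)^('n + 'n)"
  where "H2_mat A l = (let C = C_mat Star_CT A l in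
    \<i> *\<^sub>C (matrix_inv (Gamma_mat l) ** (C - ctranspose C) ** matrix_inv (Gamma_mat l)))"

definition S_mat :: "complex^'n^'n \<Rightarrow> complex \<Rightarrow> complex^('n::finite + 'n)^('n + 'n)"
  where "S_mat A l = (let C = C_mat Star_T A l in
    matrix_inv (Gamma_mat l) ** (C + transpose C) ** matrix_inv (Gamma_mat l))"

text \<open>The lower right block is the conjugate of \<open>G\<close>: if \<open>z\<^sup>T S z = 0\<close>, the form of this matrix on
  \<open>(a z, b cnj z)\<close> is then \<open>(\<bar>a\<bar>\<^sup>2 + \<bar>b\<bar>\<^sup>2) z\<^sup>* G z\<close>, which bounds its second eigenvalue from
  below. With \<open>G\<close> itself in that block there is no such bound.\<close>

definition T_block ::
  "complex^'n^'n \<Rightarrow> complex \<Rightarrow> real \<Rightarrow> complex^(('n + 'n) + ('n + 'n))^(('n + 'n) + ('n + 'n))"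
  where "T_block A l t = (let G = G_mat Star_T A l; S = S_mat A l in
    block_mat G (t *\<^sub>R conj_mat S) (t *\<^sub>R S) (conj_mat G))"

definition is_minimum :: "real \<Rightarrow> real set \<Rightarrow> bool"
  where "is_minimum m X \<longleftrightarrow> m \<in> X \<and> (\<forall>x \<in> X. m \<le> x)"

end

theory Submission
  imports Defs
begin

text \<open>
  Fix a node \<open>l\<close> and let \<open>D\<close> be a perturbation that makes the pencil singular. At \<open>s = l\<close> the
  perturbed pencil has a kernel vector \<open>x\<close>, and \<open>u = D x\<close>, \<open>v = D\<^sup>\<star> x\<close> satisfy \<open>x = M (u + l v)\<close>.
  After scaling \<open>(u, v)\<close> by \<open>Gamma_mat\<close> one gets a vector \<open>z\<close> with norm at most
  \<open>spectral_norm D * norm x\<close> at which the form of \<open>G_mat\<close> equals \<open>(norm x)\<^sup>2\<close>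
  (\<open>singular_perturbation_vector\<close>).  That \<open>v\<close> comes from the starred matrix is recorded in one
  equation only: \<open>x\<^sup>* u = v\<^sup>* x\<close> for the conjugate transpose, \<open>x\<^sup>T u = v\<^sup>T x\<close> for the transpose. The
  other matrices are multiplier terms for this equation.

  For the conjugate transpose the terms in \<open>t1\<close> and \<open>t2\<close> vanish at \<open>z\<close>, so that \<open>lambda_max\<close> of the
  sum is at least the Rayleigh quotient of \<open>G_mat\<close> at \<open>z\<close>, which is at least the inverse square of
  \<open>spectral_norm D\<close> (\<open>CT_bound\<close>). For the transpose the constraint is a bilinear equation, and the
  off-diagonal blocks vanish on the plane of the pairs \<open>(a z, b cnj z)\<close>; the Courant-Fischer principle
  bounds \<open>lambda_2\<close> from below in the same way (\<open>T_bound\<close>).  Both bounds hold for all values of the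
  parameters, and the choice \<open>D = A\<close> shows that the eigenvalues in question are positive.

  It remains to see that the minima exist. The eigenvalues depend continuously on the parameters,
  so coercivity is enough. A combination of \<open>H1_mat\<close> and \<open>H2_mat\<close> is either zero or takes a positive
  value (\<open>H_combination_zero_or_positive\<close>), hence \<open>lambda_max\<close> grows linearly on the real span
  of these two matrices. The matrix \<open>S_mat\<close> is either zero or injective (\<open>S_zero_or_injective\<close>);
  in the first case \<open>lambda_2\<close> is constant in \<open>t\<close>, in the second \<open>lambda_2\<close> grows linearly in \<open>t\<close>
  (\<open>T_coercive\<close>).
\<close>

declare transpose_matrix_vector [simp del]

section \<open>Real self-adjoint maps\<close>

text \<open>Behind every first-order optimality condition below: a linear term in \<open>s\<close> dominates the
  quadratic one for small \<open>s > 0\<close>, so it must vanish.\<close>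

lemma quadratic_nonpos_imp_zero:
  fixes a k :: real
  assumes "\<And>s. 2 * s * a + s\<^sup>2 * k \<le> 0" and "0 \<le> a"
  shows "a = 0"
proof (rule ccontr)
  assume "a \<noteq> 0"
  with assms(2) have a: "0 < a" by simp
  define s where "s = a / (\<bar>k\<bar> + 1)"
  have s: "0 < s" using a by (simp add: s_def)
  have "s * \<bar>k\<bar> \<le> a" using a by (simp add: s_def field_simps)
  then have "s * (s * \<bar>k\<bar>) \<le> s * a" using s by simp
  moreover have "s * (s * k) \<ge> - (s * (s * \<bar>k\<bar>))"
    using s by (smt (verit, best) mult_minus_right mult_left_mono)
  ultimately have "s\<^sup>2 * k \<ge> - (s * a)" by (simp add: power2_eq_square mult.assoc)
  moreover have "2 * s * a + s\<^sup>2 * k \<le> 0" by (rule assms)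
  moreover have "0 < s * a" using s a by simp
  ultimately show False by linarith
qed

text \<open>A maximiser \<open>e\<close> of the Rayleigh quotient exists by compactness. It is an eigenvector because
  varying it in the direction of its residual \<open>f e - m e\<close>, which lies in \<open>U\<close> by invariance, would
  otherwise increase the quotient. Allowing an invariant subspace \<open>U\<close> makes the lemma give the
  second eigenvalue as well, on the orthogonal complement of the first eigenvector. Complex spaces
  are handled as real ones, with the real part of the Hermitian product as inner product.\<close>

lemma selfadjoint_max_eigenvector:
  fixes f :: "'a::euclidean_space \<Rightarrow> 'a"
  assumes lin: "linear f" and sa: "\<And>x y. f x \<bullet> y = x \<bullet> f y"
    and U: "subspace U" "f ` U \<subseteq> U" and w: "w \<in> U" "w \<noteq> 0"
  obtains e m where "e \<in> U" "norm e = 1" "f e = m *\<^sub>R e"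
    "\<And>x. x \<in> U \<Longrightarrow> f x \<bullet> x \<le> m * (norm x)\<^sup>2"
proof -
  have "compact (U \<inter> sphere 0 1)"
    by (simp add: U(1) closed_Int_compact closed_subspace)
  moreover have "(1 / norm w) *\<^sub>R w \<in> U \<inter> sphere 0 1"
    using w U(1) by (simp add: subspace_scale)
  moreover have "continuous_on (U \<inter> sphere 0 1) (\<lambda>x. f x \<bullet> x)"
    by (intro continuous_intros linear_continuous_on linear_conv_bounded_linear[THEN iffD1] lin)
  ultimately obtain e where e: "e \<in> U \<inter> sphere 0 1"
      and emax: "\<And>y. y \<in> U \<inter> sphere 0 1 \<Longrightarrow> f y \<bullet> y \<le> f e \<bullet> e"
    using continuous_attains_sup[of "U \<inter> sphere 0 1" "\<lambda>x. f x \<bullet> x"] by blast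
  define m where "m = f e \<bullet> e"
  have bound: "f x \<bullet> x \<le> m * (norm x)\<^sup>2" if "x \<in> U" for x
  proof (cases "x = 0")
    case False
    have "(1 / norm x) *\<^sub>R x \<in> U \<inter> sphere 0 1"
      using that False U(1) by (simp add: subspace_scale)
    from emax[OF this] have "f x \<bullet> x / (norm x * norm x) \<le> m"
      by (simp add: linear_scale[OF lin] m_def)
    then show ?thesis
      using False by (simp add: divide_le_eq power2_eq_square)
  qed (simp add: linear_0[OF lin])
  \<comment> \<open>The residual of \<open>e\<close>, also used as the direction of the variation.\<close>
  define r where "r = f e - m *\<^sub>R e"
  have ne: "norm e = 1" "e \<in> U" using e by auto
  have r: "r \<in> U" unfolding r_def using ne U by (meson image_subset_iff subspace_diff subspace_scale)
  have "2 * s * (norm r)\<^sup>2 + s\<^sup>2 * (f r \<bullet> r - m * (norm r)\<^sup>2) \<le> 0" for s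
  proof -
    have "e + s *\<^sub>R r \<in> U" using r ne U(1) by (simp add: subspace_add subspace_scale)
    moreover have "(norm (e + s *\<^sub>R r))\<^sup>2 = 1 + 2 * s * (e \<bullet> r) + s\<^sup>2 * (norm r)\<^sup>2"
      using ne unfolding norm_eq_1 power2_norm_eq_inner
      by (simp add: inner_add_left inner_add_right inner_commute power2_eq_square algebra_simps)
    ultimately have "f (e + s *\<^sub>R r) \<bullet> (e + s *\<^sub>R r) \<le> m * (1 + 2 * s * (e \<bullet> r) + s\<^sup>2 * (norm r)\<^sup>2)"
      using bound[of "e + s *\<^sub>R r"] by simp
    moreover have "f (e + s *\<^sub>R r) \<bullet> (e + s *\<^sub>R r)
        = f e \<bullet> e + s * (f e \<bullet> r) + s * (f r \<bullet> e) + s\<^sup>2 * (f r \<bullet> r)"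
      by (simp add: linear_add[OF lin] linear_scale[OF lin]
          inner_add_left inner_add_right power2_eq_square algebra_simps)
    ultimately have "f e \<bullet> e + s * (f e \<bullet> r) + s * (f r \<bullet> e) + s\<^sup>2 * (f r \<bullet> r)
        \<le> m * (1 + 2 * s * (e \<bullet> r) + s\<^sup>2 * (norm r)\<^sup>2)"
      by linarith
    moreover have "f r \<bullet> e = f e \<bullet> r" by (metis sa inner_commute)
    moreover have "(norm r)\<^sup>2 = f e \<bullet> r - m * (e \<bullet> r)"
      unfolding power2_norm_eq_inner by (metis inner_diff_left inner_scaleR_left r_def)
    then have "f e \<bullet> r = (norm r)\<^sup>2 + m * (e \<bullet> r)" by simp
    moreover have "f e \<bullet> e = m" by (simp add: m_def)
    ultimately show ?thesis by (simp only:) (simp add: algebra_simps)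
  qed
  then have "(norm r)\<^sup>2 = 0" by (rule quadratic_nonpos_imp_zero) simp
  then have "f e = m *\<^sub>R e" by (simp add: r_def)
  with ne bound that show thesis by blast
qed

text \<open>The form at \<open>x + f x\<close> has the cross term \<open>2 (norm (f x))\<^sup>2\<close>.\<close>

lemma selfadjoint_zero_form_imp_zero:
  fixes f :: "'a::real_inner \<Rightarrow> 'a"
  assumes lin: "linear f" and sa: "\<And>x y. f x \<bullet> y = x \<bullet> f y"
    and zero: "\<And>x. f x \<bullet> x = 0"
  shows "f x = 0"
proof -
  have "f (x + f x) \<bullet> (x + f x) = 0" by (rule zero)
  then have "f x \<bullet> f x + f (f x) \<bullet> x = 0"
    using zero[of x] zero[of "f x"]
    by (simp add: linear_add[OF lin] inner_add_left inner_add_right)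
  moreover have "f (f x) \<bullet> x = f x \<bullet> f x" by (rule sa)
  ultimately show ?thesis by simp
qed

section \<open>Hermitian matrices and their quadratic forms\<close>

text \<open>The Hermitian inner product, conjugate linear in the first argument; its real part is the
  inner product that the library puts on \<open>complex^'n\<close>.\<close>

definition cip :: "complex^'n \<Rightarrow> complex^'n \<Rightarrow> complex"
  where "cip x y = (\<Sum>i\<in>UNIV. cnj (x $ i) * y $ i)"

definition cnjv :: "complex^'n \<Rightarrow> complex^'n"
  where "cnjv x = (\<chi> i. cnj (x $ i))"

definition hermitian :: "complex^'n^'n \<Rightarrow> bool"
  where "hermitian H \<longleftrightarrow> ctranspose H = H"

definition qform :: "complex^'n^'n \<Rightarrow> complex^'n \<Rightarrow> real"
  where "qform H x = (H *v x) \<bullet> x"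

lemma scaleR_eq_smult: "r *\<^sub>R (x::complex^'n) = complex_of_real r *s x"
  by (simp add: vec_eq_iff scaleR_conv_of_real[of r "_::complex"])

lemma inner_complex_Re: "(a::complex) \<bullet> b = Re (cnj a * b)"
  by (simp add: inner_complex_def)

lemma inner_eq_Re_cip: "x \<bullet> y = Re (cip x y)"
  by (simp add: inner_vec_def cip_def inner_complex_Re)

lemma cip_add_right [simp]: "cip x (y + z) = cip x y + cip x z"
  and cip_add_left [simp]: "cip (x + y) z = cip x z + cip y z"
  and cip_diff_right [simp]: "cip x (y - z) = cip x y - cip x z"
  and cip_diff_left [simp]: "cip (x - y) z = cip x z - cip y z"
  and cip_smult_right [simp]: "cip x (c *s y) = c * cip x y"
  and cip_smult_left [simp]: "cip (c *s x) y = cnj c * cip x y"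
  and cip_scaleR_right [simp]: "cip x (r *\<^sub>R y) = of_real r * cip x y"
  and cip_scaleR_left [simp]: "cip (r *\<^sub>R x) y = of_real r * cip x y"
  and cip_zero_right [simp]: "cip x 0 = 0"
  and cip_zero_left [simp]: "cip 0 x = 0"
  by (simp_all add: cip_def algebra_simps sum.distrib sum_subtractf sum_distrib_left
      scaleR_conv_of_real[of r "_::complex"])

lemma cip_commute: "cip y x = cnj (cip x y)"
  by (simp add: cip_def mult.commute)

lemma cip_self: "cip x x = complex_of_real ((norm x)\<^sup>2)"
proof -
  have "Re (cip x x) = (norm x)\<^sup>2" by (metis inner_eq_Re_cip power2_norm_eq_inner)
  moreover have "Im (cip x x) = 0"
    by (simp add: cip_def)
  ultimately show ?thesis by (simp add: complex_eq_iff)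
qed

lemma cip_matrix: "cip x (A *v y) = cip (ctranspose A *v x) y"
proof -
  have "cip x (A *v y) = (\<Sum>i\<in>UNIV. \<Sum>j\<in>UNIV. cnj (x $ i) * A $ i $ j * y $ j)"
    by (simp add: cip_def matrix_vector_mult_def sum_distrib_left mult.assoc)
  also have "\<dots> = (\<Sum>j\<in>UNIV. \<Sum>i\<in>UNIV. cnj (x $ i) * A $ i $ j * y $ j)"
    by (rule sum.swap)
  also have "\<dots> = cip (ctranspose A *v x) y"
    by (simp add: cip_def ctranspose_def conj_mat_def transpose_def matrix_vector_mult_def
        sum_distrib_left sum_distrib_right ac_simps)
  finally show ?thesis .
qed

lemma ctranspose_ctranspose [simp]: "ctranspose (ctranspose A) = A"
  by (simp add: ctranspose_def conj_mat_def transpose_def vec_eq_iff)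

lemma cip_matrix_left: "cip (A *v x) y = cip x (ctranspose A *v y)"
  by (simp add: cip_matrix)

lemma norm_smult [simp]: "norm (c *s (x::complex^'n)) = cmod c * norm x"
proof -
  have "complex_of_real ((norm (c *s x))\<^sup>2) = (c * cnj c) * cip x x"
    unfolding cip_self[symmetric] by (simp add: mult.assoc)
  also have "\<dots> = complex_of_real ((cmod c * norm x)\<^sup>2)"
    unfolding cip_self complex_norm_square[symmetric] by (simp add: power_mult_distrib)
  finally have "complex_of_real ((norm (c *s x))\<^sup>2) = complex_of_real ((cmod c * norm x)\<^sup>2)" .
  then have "(norm (c *s x))\<^sup>2 = (cmod c * norm x)\<^sup>2" by (simp only: of_real_eq_iff)
  then show ?thesis by (simp add: power2_eq_iff_nonneg)
qed

lemma matrix_smult: "A *v (c *s x) = c *s (A *v (x::complex^'n))"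
  by (simp add: vec_eq_iff matrix_vector_mult_def sum_distrib_left algebra_simps)

lemma hermitian_selfadjoint:
  assumes "hermitian H" shows "(H *v x) \<bullet> y = x \<bullet> (H *v y)"
  using assms by (simp add: inner_eq_Re_cip cip_matrix hermitian_def)

lemma hermitian_max_eigenvector:
  assumes H: "hermitian H" and U: "subspace U" "(*v) H ` U \<subseteq> U" and w: "w \<in> U" "w \<noteq> 0"
  obtains e m where "e \<in> U" "norm e = 1" "H *v e = m *\<^sub>R e"
    "\<And>x. x \<in> U \<Longrightarrow> qform H x \<le> m * (norm x)\<^sup>2"
  using selfadjoint_max_eigenvector[OF matrix_vector_mul_linear hermitian_selfadjoint[OF H] U w]
  unfolding qform_def by metis

lemma mem_eigenspace: "v \<in> eigenspace H x \<longleftrightarrow> H *v v = x *\<^sub>R v"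
  by (simp add: eigenspace_def scaleR_eq_smult)

lemma qform_eigenspace: "v \<in> eigenspace H x \<Longrightarrow> qform H v = x * (norm v)\<^sup>2"
  by (simp add: mem_eigenspace qform_def power2_norm_eq_inner)

lemma eigenspaces_orthogonal:
  assumes "hermitian H" "v \<in> eigenspace H x" "w \<in> eigenspace H y" "x \<noteq> y"
  shows "v \<bullet> w = 0"
  using hermitian_selfadjoint[OF assms(1), of v w] assms(2-) by (simp add: mem_eigenspace)

text \<open>Eigenvectors for different eigenvalues are orthogonal, hence independent over the reals.\<close>

lemma finite_eigvals:
  assumes "hermitian H" shows "finite (eigvals H)"
proof -
  have "\<forall>x\<in>eigvals H. \<exists>v. v \<in> eigenspace H x \<and> v \<noteq> 0" by (auto simp: eigvals_def)
  then obtain v where v: "\<And>x. x \<in> eigvals H \<Longrightarrow> v x \<in> eigenspace H x \<and> v x \<noteq> 0" by metis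
  have inj: "inj_on v (eigvals H)"
  proof (rule inj_onI, rule ccontr)
    fix x y assume "x \<in> eigvals H" "y \<in> eigvals H" "v x = v y" "x \<noteq> y"
    then show False using eigenspaces_orthogonal[OF assms, of "v x" x "v y" y] v[of x] v[of y] by simp
  qed
  have "pairwise orthogonal (v ` eigvals H)"
    using eigenspaces_orthogonal[OF assms] v by (auto simp: pairwise_def orthogonal_def) metis
  moreover have "0 \<notin> v ` eigvals H" using v by auto
  ultimately have "finite (v ` eigvals H)"
    using pairwise_orthogonal_independent independent_imp_finite by blast
  then show ?thesis using inj finite_image_iff by blast
qed

lemma lambda_max_ge:
  assumes "hermitian H" shows "qform H x \<le> lambda_max H * (norm x)\<^sup>2"
proof (cases "x = 0")
  case False
  obtain e m where e: "norm e = 1" "H *v e = m *\<^sub>R e" "qform H x \<le> m * (norm x)\<^sup>2"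
    using hermitian_max_eigenvector[OF assms subspace_UNIV _ _ False] by (metis UNIV_I subset_UNIV)
  then have "m \<in> eigvals H" by (auto simp: eigvals_def mem_eigenspace intro!: bexI[of _ e])
  then have "m \<le> lambda_max H"
    unfolding lambda_max_def using finite_eigvals[OF assms] by simp
  then show ?thesis using e(3) by (smt (verit) mult_right_mono zero_le_power2)
qed (simp add: qform_def)

lemma lambda_max_attained:
  assumes "hermitian (H::complex^'n^'n)"
  obtains e where "norm e = 1" "qform H e = lambda_max H"
proof -
  have "(1::complex^'n) \<noteq> 0" by (simp add: vec_eq_iff)
  then obtain e m where e: "norm e = 1" "H *v e = m *\<^sub>R e"
    using hermitian_max_eigenvector[OF assms subspace_UNIV] by (metis UNIV_I subset_UNIV)
  then have "m \<in> eigvals H" by (auto simp: eigvals_def mem_eigenspace intro!: bexI[of _ e])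
  then have "eigvals H \<noteq> {}" by blast
  then have "lambda_max H \<in> eigvals H"
    unfolding lambda_max_def using finite_eigvals[OF assms] by (rule Max_in[rotated])
  then obtain v where v: "v \<in> eigenspace H (lambda_max H)" "v \<noteq> 0" by (auto simp: eigvals_def)
  have "(1 / norm v) *\<^sub>R v \<in> eigenspace H (lambda_max H)"
    using v by (simp add: mem_eigenspace scaleR_eq_smult matrix_smult vector_smult_assoc mult.commute)
  from qform_eigenspace[OF this] v(2) that[of "(1 / norm v) *\<^sub>R v"] show thesis by simp
qed

section \<open>The second eigenvalue\<close>

text \<open>The second eigenvalue is accessed through the Courant-Fischer principle only: it is the largest
  \<open>c\<close> such that the form of \<open>H\<close> is at least \<open>c\<close> times the squared norm on some plane of complex
  dimension two.\<close>

definition indep2 :: "complex^'n \<Rightarrow> complex^'n \<Rightarrow> bool"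
  where "indep2 p q \<longleftrightarrow> (\<forall>a b. a *s p + b *s q = 0 \<longrightarrow> a = 0 \<and> b = 0)"

definition plane_bound :: "complex^'n^'n \<Rightarrow> real \<Rightarrow> bool"
  where "plane_bound H c \<longleftrightarrow> (\<exists>p q. indep2 p q \<and>
    (\<forall>a b. c * (norm (a *s p + b *s q))\<^sup>2 \<le> qform H (a *s p + b *s q)))"

lemma indep2_orthogonal:
  assumes "cip p q = 0" "p \<noteq> 0" "q \<noteq> 0" shows "indep2 p q"
  unfolding indep2_def
proof (intro allI impI)
  fix a b assume *: "a *s p + b *s q = 0"
  have "cip p (a *s p + b *s q) = 0" unfolding * by simp
  then have "a = 0" using assms by (simp add: cip_self)
  with * assms(3) show "a = 0 \<and> b = 0" by simp
qed

lemma vec_subspace_eigenspace: "vec.subspace (eigenspace H x)"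
  by (simp add: vec.subspace_def eigenspace_def matrix_vector_right_distrib matrix_smult
      vector_add_ldistrib vector_smult_assoc mult.commute)

lemma dim_eigenspace_ge_1:
  assumes "x \<in> eigvals H" shows "1 \<le> vec.dim (eigenspace H x)"
proof -
  from assms obtain v where "v \<in> eigenspace H x" "v \<noteq> 0" by (auto simp: eigvals_def)
  then have "card {v} \<le> vec.dim (eigenspace H x)"
    by (intro vec.independent_card_le_dim) (auto simp: vec.dependent_single)
  then show ?thesis by simp
qed

lemma dim_eigenspace_ge_2_iff:
  "2 \<le> vec.dim (eigenspace H x) \<longleftrightarrow> (\<exists>p\<in>eigenspace H x. \<exists>q\<in>eigenspace H x. indep2 p q)"
proof
  assume "2 \<le> vec.dim (eigenspace H x)"
  moreover obtain B where B: "B \<subseteq> eigenspace H x" "vec.independent B"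
      "eigenspace H x \<subseteq> vec.span B" "card B = vec.dim (eigenspace H x)"
    by (rule vec.basis_exists)
  ultimately obtain T where "T \<subseteq> B" "card T = 2"
    by (metis obtain_subset_with_card_n)
  then obtain p q where pq: "p \<in> B" "q \<in> B" "p \<noteq> q"
    by (auto simp: card_2_iff)
  then have ind: "vec.independent {p, q}" using vec.independent_mono[OF B(2)] pq(1,2) by simp
  have "indep2 p q"
    unfolding indep2_def
  proof (intro allI impI)
    fix a b assume *: "a *s p + b *s q = 0"
    have s: "(\<Sum>v\<in>{p,q}. (if v = p then a else b) *s v) = 0" using pq(3) * by simp
    show "a = 0 \<and> b = 0"
      using vec.independentD[OF ind _ order_refl s, of p] vec.independentD[OF ind _ order_refl s, of q]
        pq(3) by auto
  qed
  with pq B(1) show "\<exists>p\<in>eigenspace H x. \<exists>q\<in>eigenspace H x. indep2 p q" by blast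
next
  assume "\<exists>p\<in>eigenspace H x. \<exists>q\<in>eigenspace H x. indep2 p q"
  then obtain p q where pq: "p \<in> eigenspace H x" "q \<in> eigenspace H x" "indep2 p q" by blast
  have ne: "p \<noteq> q"
  proof
    assume "p = q"
    then have "1 *s p + (-1) *s q = 0" by simp
    with pq(3) show False unfolding indep2_def by (metis zero_neq_one)
  qed
  have "vec.independent {p, q}"
  proof
    assume "vec.dependent {p, q}"
    then obtain u v where u: "(\<Sum>v\<in>{p,q}. u v *s v) = 0" "v \<in> {p,q}" "u v \<noteq> 0"
      by (subst (asm) vec.dependent_finite) auto
    from u(1) ne have "u p *s p + u q *s q = 0" by simp
    with pq(3) have "u p = 0 \<and> u q = 0" unfolding indep2_def by blast
    with u show False by auto
  qed
  then have "card {p, q} \<le> vec.dim (eigenspace H x)"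
    using pq by (intro vec.independent_card_le_dim) auto
  with ne show "2 \<le> vec.dim (eigenspace H x)" by simp
qed

text \<open>The set whose maximum defines \<open>lambda_2\<close>.\<close>

definition second_eigvals :: "complex^'n^'n \<Rightarrow> real set"
  where "second_eigvals H =
    {x \<in> eigvals H. 2 \<le> (\<Sum>y \<in> {y \<in> eigvals H. x \<le> y}. vec.dim (eigenspace H y))}"

text \<open>A plane contains a nonzero vector orthogonal to a top eigenvector \<open>e\<close>. So the maximum \<open>k\<close> of
  the Rayleigh quotient on the complement of \<open>e\<close> is at least \<open>c\<close>; and \<open>k\<close> is an eigenvalue that,
  together with that of \<open>e\<close>, accounts for two dimensions of eigenspaces.\<close>

lemma plane_bound_imp_second_eigval:
  assumes H: "hermitian H" and pb: "plane_bound H c"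
  obtains x where "x \<in> second_eigvals H" "c \<le> x"
proof -
  obtain p q where pq: "indep2 p q"
      "\<And>a b. c * (norm (a *s p + b *s q))\<^sup>2 \<le> qform H (a *s p + b *s q)"
    using pb by (auto simp: plane_bound_def)
  have p: "p \<noteq> 0"
  proof
    assume "p = 0"
    then have "1 *s p + 0 *s q = 0" by simp
    with pq(1) show False unfolding indep2_def by (metis zero_neq_one)
  qed
  obtain e m where e: "norm e = 1" "H *v e = m *\<^sub>R e" "\<And>x. qform H x \<le> m * (norm x)\<^sup>2"
    using hermitian_max_eigenvector[OF H subspace_UNIV _ _ p] by (metis UNIV_I subset_UNIV)
  define U where "U = {y. cip e y = 0}"
  have U: "subspace U" by (auto simp: U_def subspace_def)
  have inv: "(*v) H ` U \<subseteq> U"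
  proof -
    have "cip e (H *v y) = of_real m * cip e y" for y
      using H e(2) by (simp add: cip_matrix hermitian_def)
    then show ?thesis by (auto simp: U_def)
  qed
  \<comment> \<open>One linear condition on two coefficients has a nonzero solution.\<close>
  obtain a b where ab: "a *s p + b *s q \<in> U" "a \<noteq> 0 \<or> b \<noteq> 0"
  proof (cases "cip e p = 0")
    case True
    then have "1 *s p + 0 *s q \<in> U" by (simp add: U_def)
    then show ?thesis using that by (metis zero_neq_one)
  next
    case False
    have "cip e q *s p + (- cip e p) *s q \<in> U" by (simp add: U_def)
    then show ?thesis using that False by (metis neg_equal_0_iff_equal)
  qed
  define w where "w = a *s p + b *s q"
  have w: "w \<in> U" "w \<noteq> 0" using ab pq(1) by (auto simp: w_def indep2_def)
  obtain f k where f: "f \<in> U" "norm f = 1" "H *v f = k *\<^sub>R f"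
      "\<And>x. x \<in> U \<Longrightarrow> qform H x \<le> k * (norm x)\<^sup>2"
    using hermitian_max_eigenvector[OF H U inv w] by metis
  have "c * (norm w)\<^sup>2 \<le> k * (norm w)\<^sup>2"
    using pq(2)[of a b] f(4)[OF w(1)] by (simp add: w_def)
  then have "c \<le> k" using w(2) by simp
  have km: "k \<le> m"
    using e(3)[of f] f(2,3) by (simp add: qform_def norm_eq_1)
  have ev: "f \<in> eigenspace H k" "e \<in> eigenspace H m" using e f by (auto simp: mem_eigenspace)
  have nz: "e \<noteq> 0" "f \<noteq> 0" using e f by auto
  have ke: "k \<in> eigvals H" "m \<in> eigvals H" using ev nz by (auto simp: eigvals_def)
  note fin = finite_eigvals[OF H]
  have "2 \<le> (\<Sum>y \<in> {y \<in> eigvals H. k \<le> y}. vec.dim (eigenspace H y))"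
  proof (cases "k = m")
    case True
    have "indep2 e f" using f(1) nz by (intro indep2_orthogonal) (auto simp: U_def)
    then have "2 \<le> vec.dim (eigenspace H k)" using ev True dim_eigenspace_ge_2_iff by blast
    also have "\<dots> \<le> (\<Sum>y \<in> {y \<in> eigvals H. k \<le> y}. vec.dim (eigenspace H y))"
      using ke fin by (intro member_le_sum) auto
    finally show ?thesis .
  next
    case False
    have "2 \<le> (\<Sum>y \<in> {k, m}. vec.dim (eigenspace H y))"
      using False dim_eigenspace_ge_1[OF ke(1)] dim_eigenspace_ge_1[OF ke(2)] by simp
    also have "\<dots> \<le> (\<Sum>y \<in> {y \<in> eigvals H. k \<le> y}. vec.dim (eigenspace H y))"
      using ke km fin by (intro sum_mono2) auto
    finally show ?thesis .
  qed
  with ke have "k \<in> second_eigvals H" by (simp add: second_eigvals_def)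
  with \<open>c \<le> k\<close> that show thesis by blast
qed

text \<open>Two independent eigenvectors with eigenvalues at least \<open>x\<close> span the plane. If they belong to
  different eigenvalues they are orthogonal, and the form splits.\<close>

lemma second_eigval_imp_plane_bound:
  assumes H: "hermitian H" and x: "x \<in> second_eigvals H"
  shows "plane_bound H x"
proof -
  define Y where "Y = {y \<in> eigvals H. x \<le> y}"
  have s: "2 \<le> (\<Sum>y \<in> Y. vec.dim (eigenspace H y))" and xe: "x \<in> eigvals H"
    using x by (auto simp: second_eigvals_def Y_def)
  have xY: "x \<in> Y" using xe by (simp add: Y_def)
  show ?thesis
  proof (cases "Y = {x}")
    case True
    with s obtain p q where pq: "p \<in> eigenspace H x" "q \<in> eigenspace H x" "indep2 p q"
      using dim_eigenspace_ge_2_iff[of H x] by auto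
    have "a *s p + b *s q \<in> eigenspace H x" for a b
      using pq vec_subspace_eigenspace by (meson vec.subspace_add vec.subspace_scale)
    then show ?thesis
      unfolding plane_bound_def using pq(3) qform_eigenspace by (metis order_refl)
  next
    case False
    with xY obtain y where y: "y \<in> Y" "y \<noteq> x" by blast
    obtain p q where pq: "p \<in> eigenspace H x" "q \<in> eigenspace H y" "p \<noteq> 0" "q \<noteq> 0"
      using xY y by (auto simp: Y_def eigvals_def)
    have sc: "a *s p \<in> eigenspace H x" "a *s q \<in> eigenspace H y" for a
      using pq vec_subspace_eigenspace by (meson vec.subspace_scale)+
    have orth: "(a *s p) \<bullet> (b *s q) = 0" for a b
      using eigenspaces_orthogonal[OF H sc] y(2) by metis
    have "indep2 p q"
      unfolding indep2_def
    proof (intro allI impI)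
      fix a b assume *: "a *s p + b *s q = 0"
      then have "(a *s p) \<bullet> (a *s p + b *s q) = 0" "(b *s q) \<bullet> (a *s p + b *s q) = 0" by simp_all
      then have "a *s p = 0" "b *s q = 0"
        using orth[of a b] by (simp_all add: inner_add_right inner_commute)
      then show "a = 0 \<and> b = 0" using pq by simp
    qed
    moreover have "x * (norm (a *s p + b *s q))\<^sup>2 \<le> qform H (a *s p + b *s q)" for a b
    proof -
      let ?u = "a *s p" and ?v = "b *s q"
      have "(norm (?u + ?v))\<^sup>2 = (norm ?u)\<^sup>2 + (norm ?v)\<^sup>2"
        using orth[of a b] by (simp add: power2_norm_eq_inner inner_add_left inner_add_right inner_commute del: norm_smult)
      moreover have "qform H (?u + ?v) = x * (norm ?u)\<^sup>2 + y * (norm ?v)\<^sup>2"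
        using sc[of a] sc[of b] orth[of a b]
        by (simp add: qform_def mem_eigenspace matrix_vector_right_distrib inner_add_left
            inner_add_right inner_commute power2_norm_eq_inner del: norm_smult)
      moreover have "x * (norm ?v)\<^sup>2 \<le> y * (norm ?v)\<^sup>2"
        using y(1) by (intro mult_right_mono) (auto simp: Y_def)
      ultimately show ?thesis by (simp add: distrib_left)
    qed
    ultimately show ?thesis unfolding plane_bound_def by blast
  qed
qed

text \<open>Together with the next lemma: \<open>plane_bound H c\<close> holds with \<open>c = lambda_2 H\<close>, and with no larger
  \<open>c\<close>.\<close>

lemma lambda_2_ge:
  assumes "hermitian H" "plane_bound H c" shows "c \<le> lambda_2 H"
proof -
  obtain x where "x \<in> second_eigvals H" "c \<le> x"
    using plane_bound_imp_second_eigval[OF assms] .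
  moreover have "finite (second_eigvals H)"
    using finite_eigvals[OF assms(1)] by (simp add: second_eigvals_def)
  ultimately have "x \<le> lambda_2 H" unfolding lambda_2_def second_eigvals_def[symmetric] by simp
  with \<open>c \<le> x\<close> show ?thesis by simp
qed

lemma lambda_2_attained:
  assumes "hermitian H" "plane_bound H c" shows "plane_bound H (lambda_2 H)"
proof -
  have "finite (second_eigvals H)"
    using finite_eigvals[OF assms(1)] by (simp add: second_eigvals_def)
  moreover have "second_eigvals H \<noteq> {}"
    using plane_bound_imp_second_eigval[OF assms] by blast
  ultimately have "lambda_2 H \<in> second_eigvals H"
    unfolding lambda_2_def second_eigvals_def[symmetric] by (rule Max_in)
  then show ?thesis by (rule second_eigval_imp_plane_bound[OF assms(1)])
qed

section \<open>Continuity of the eigenvalues and attainment of minima\<close>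

lemma coercive_attains_min:
  fixes F :: "'a::euclidean_space \<Rightarrow> real"
  assumes S: "closed S" "s0 \<in> S" and cont: "continuous_on S F"
    and e: "0 < e" and coercive: "\<And>x. x \<in> S \<Longrightarrow> e * norm x \<le> F x"
  obtains x where "x \<in> S" "\<And>y. y \<in> S \<Longrightarrow> F x \<le> F y"
proof -
  define R where "R = F s0 / e"
  have "s0 \<in> S \<inter> cball 0 R"
    using coercive[OF S(2)] e S(2) by (simp add: R_def field_simps)
  moreover have "compact (S \<inter> cball 0 R)" using S(1) by (simp add: closed_Int_compact)
  moreover have "continuous_on (S \<inter> cball 0 R) F" using cont by (rule continuous_on_subset) simp
  ultimately obtain x where x: "x \<in> S \<inter> cball 0 R" "\<And>y. y \<in> S \<inter> cball 0 R \<Longrightarrow> F x \<le> F y"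
    using continuous_attains_inf[of "S \<inter> cball 0 R" F] by blast
  have "F x \<le> F y" if "y \<in> S" for y
  proof (cases "y \<in> cball 0 R")
    case False
    then have "F s0 < e * norm y" using e by (simp add: R_def field_simps)
    also have "\<dots> \<le> F y" using coercive that by simp
    finally show ?thesis using x(2) \<open>s0 \<in> S \<inter> cball 0 R\<close> by fastforce
  qed (use x that in auto)
  with x(1) that show thesis by blast
qed

lemma matrix_scaleR_left: "(r *\<^sub>R (A::complex^'n^'m)) *v x = r *\<^sub>R (A *v x)"
  by (simp add: vec_eq_iff matrix_vector_mult_def scaleR_sum_right)

text \<open>Any constant \<open>K\<close> serves: it only enters as a Lipschitz constant of the eigenvalues.\<close>

lemma qform_bound:
  "\<exists>K\<ge>0. \<forall>(H::complex^'n^'n) x. \<bar>qform H x\<bar> \<le> K * norm H * (norm x)\<^sup>2"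
proof -
  have "bilinear ((*v) :: complex^'n^'n \<Rightarrow> _)"
    unfolding bilinear_def
    by (auto intro!: linearI simp: matrix_vector_mult_add_rdistrib matrix_scaleR_left
        matrix_vector_right_distrib scaleR_eq_smult matrix_smult)
  then obtain K where K: "0 < K" "\<And>(H::complex^'n^'n) x. norm (H *v x) \<le> norm H * norm x * K"
    using bounded_bilinear.pos_bounded bilinear_conv_bounded_bilinear by blast
  have "\<bar>qform H x\<bar> \<le> K * norm H * (norm x)\<^sup>2" for H :: "complex^'n^'n" and x
  proof -
    have "\<bar>qform H x\<bar> \<le> norm (H *v x) * norm x"
      unfolding qform_def by (rule Cauchy_Schwarz_ineq2)
    also have "\<dots> \<le> (norm H * norm x * K) * norm x" using K(2) by (intro mult_right_mono) auto
    finally show ?thesis by (simp add: power2_eq_square ac_simps)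
  qed
  with K(1) show ?thesis by (meson less_imp_le)
qed

lemma qform_diff: "qform (X - Y) x = qform X x - qform Y x"
  by (simp add: qform_def matrix_vector_mult_diff_rdistrib inner_diff_left)

lemma qform_add: "qform (X + Y) x = qform X x + qform Y x"
  by (simp add: qform_def matrix_vector_mult_add_rdistrib inner_add_left)

lemma continuous_on_lambda_max:
  "continuous_on (Collect hermitian) (lambda_max :: complex^'n^'n \<Rightarrow> real)"
proof -
  obtain K where K: "0 \<le> K" "\<And>(H::complex^'n^'n) x. \<bar>qform H x\<bar> \<le> K * norm H * (norm x)\<^sup>2"
    using qform_bound by blast
  have le: "lambda_max X - lambda_max Y \<le> K * norm (X - Y)"
    if hX: "hermitian X" and hY: "hermitian Y" for X Y :: "complex^'n^'n"
  proof -
    obtain e where e: "norm e = 1" "qform X e = lambda_max X"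
      using lambda_max_attained[OF hX] .
    have "qform X e - qform Y e \<le> K * norm (X - Y)"
      using K(2)[of "X - Y" e] e(1) by (simp add: qform_diff)
    then show ?thesis using lambda_max_ge[OF hY, of e] e by simp
  qed
  have "K-lipschitz_on (Collect hermitian) (lambda_max :: complex^'n^'n \<Rightarrow> real)"
  proof (rule lipschitz_onI)
    fix X Y :: "complex^'n^'n" assume "X \<in> Collect hermitian" "Y \<in> Collect hermitian"
    then show "dist (lambda_max X) (lambda_max Y) \<le> K * dist X Y"
      using le[of X Y] le[of Y X] by (simp add: dist_norm abs_le_iff norm_minus_commute)
  qed (rule K(1))
  then show ?thesis by (rule lipschitz_on_continuous_on)
qed

text \<open>The plane that is optimal for \<open>X\<close> is a competitor for \<open>Y\<close>; this is what makes \<open>lambda_2\<close>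
  Lipschitz continuous.\<close>

lemma plane_bound_perturb:
  assumes pb: "plane_bound X c" and d: "\<And>x. qform X x - d * (norm x)\<^sup>2 \<le> qform Y x"
  shows "plane_bound Y (c - d)"
proof -
  obtain p q where pq: "indep2 p q"
      "\<And>a b. c * (norm (a *s p + b *s q))\<^sup>2 \<le> qform X (a *s p + b *s q)"
    using pb by (auto simp: plane_bound_def)
  have "(c - d) * (norm (a *s p + b *s q))\<^sup>2 \<le> qform Y (a *s p + b *s q)" for a b
    using pq(2)[of a b] d[of "a *s p + b *s q"] unfolding left_diff_distrib by linarith
  with pq(1) show ?thesis unfolding plane_bound_def by blast
qed

lemma indep2_axis:
  assumes "i \<noteq> j" shows "indep2 (axis i 1) (axis j (1::complex))"
  using assms by (intro indep2_orthogonal) (auto simp: cip_def axis_def if_distrib if_distribR sum.delta vec_eq_iff cong: if_cong)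

lemma plane_bound_exists:
  assumes "(i::'n) \<noteq> j" obtains c where "plane_bound (H::complex^'n^'n) c"
proof -
  obtain K where K: "0 \<le> K" "\<And>(H::complex^'n^'n) x. \<bar>qform H x\<bar> \<le> K * norm H * (norm x)\<^sup>2"
    using qform_bound by blast
  have "- (K * norm H) * (norm x)\<^sup>2 \<le> qform H x" for x
    using K(2)[of H x] by simp
  with indep2_axis[OF assms] have "plane_bound H (- (K * norm H))"
    unfolding plane_bound_def by blast
  then show thesis by (rule that)
qed

lemma continuous_on_lambda_2:
  assumes "(i::'n) \<noteq> j"
  shows "continuous_on (Collect hermitian) (lambda_2 :: complex^'n^'n \<Rightarrow> real)"
proof -
  obtain K where K: "0 \<le> K" "\<And>(H::complex^'n^'n) x. \<bar>qform H x\<bar> \<le> K * norm H * (norm x)\<^sup>2"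
    using qform_bound by blast
  have le: "lambda_2 X - lambda_2 Y \<le> K * norm (X - Y)"
    if hX: "hermitian X" and hY: "hermitian Y" for X Y :: "complex^'n^'n"
  proof -
    obtain c where "plane_bound X c" using plane_bound_exists[OF assms] .
    then have "plane_bound X (lambda_2 X)" by (rule lambda_2_attained[OF hX])
    moreover have "qform X x - K * norm (X - Y) * (norm x)\<^sup>2 \<le> qform Y x" for x
      using K(2)[of "X - Y" x] by (simp add: qform_diff)
    ultimately have "plane_bound Y (lambda_2 X - K * norm (X - Y))" by (rule plane_bound_perturb)
    from lambda_2_ge[OF hY this] show ?thesis by simp
  qed
  have "K-lipschitz_on (Collect hermitian) (lambda_2 :: complex^'n^'n \<Rightarrow> real)"
  proof (rule lipschitz_onI)
    fix X Y :: "complex^'n^'n" assume "X \<in> Collect hermitian" "Y \<in> Collect hermitian"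
    then show "dist (lambda_2 X) (lambda_2 Y) \<le> K * dist X Y"
      using le[of X Y] le[of Y X] by (simp add: dist_norm abs_le_iff norm_minus_commute)
  qed (rule K(1))
  then show ?thesis by (rule lipschitz_on_continuous_on)
qed

lemma hermitianI:
  assumes "\<And>x y. cip x (H *v y) = cip (H *v x) y" shows "hermitian H"
proof -
  have "ctranspose H *v x = H *v x" for x
  proof -
    have "cip (ctranspose H *v x - H *v x) y = 0" for y
      using assms[of x y] by (simp add: cip_matrix)
    from this[of "ctranspose H *v x - H *v x"] show ?thesis unfolding cip_self by simp
  qed
  then show ?thesis by (simp add: hermitian_def matrix_eq)
qed

lemma hermitian_zero_if_form_zero:
  assumes "hermitian H" "\<And>x. qform H x = 0" shows "H = 0"
  using selfadjoint_zero_form_imp_zero[OF matrix_vector_mul_linear hermitian_selfadjoint[OF assms(1)]]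
    assms(2) by (simp add: qform_def matrix_eq)

lemma hermitian_add: "hermitian X \<Longrightarrow> hermitian Y \<Longrightarrow> hermitian (X + Y)"
  by (simp add: hermitian_def ctranspose_def conj_mat_def transpose_def vec_eq_iff)

text \<open>The positivity assumption excludes directions in which \<open>lambda_max\<close> fails to grow: by
  compactness of the unit sphere of \<open>V\<close>, \<open>lambda_max X\<close> is at least a positive multiple of the norm
  of \<open>X\<close>, and adding the positive semidefinite \<open>G\<close> preserves this. Minimising over the space \<open>V\<close>
  of matrices rather than over coefficients allows linearly dependent generators, for which the
  function of the coefficients is not coercive.\<close>

lemma lambda_max_subspace_attains_min:
  fixes G :: "complex^'n^'n"
  assumes G: "hermitian G" "\<And>x. 0 \<le> qform G x"
    and V: "subspace V" "\<And>X. X \<in> V \<Longrightarrow> hermitian X"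
    and pos: "\<And>X. X \<in> V \<Longrightarrow> X \<noteq> 0 \<Longrightarrow> \<exists>x. 0 < qform X x"
  obtains X where "X \<in> V" "\<And>Y. Y \<in> V \<Longrightarrow> lambda_max (G + X) \<le> lambda_max (G + Y)"
proof -
  have pos': "0 < lambda_max X" if X: "X \<in> V" "X \<noteq> 0" for X
  proof -
    obtain x where "0 < qform X x" using pos X by blast
    then have "0 < lambda_max X * (norm x)\<^sup>2"
      using lambda_max_ge[OF V(2)[OF X(1)], of x] by linarith
    then show ?thesis by (simp add: zero_less_mult_iff)
  qed
  have comp: "compact (V \<inter> sphere 0 1)"
    by (simp add: V(1) closed_Int_compact closed_subspace)
  have contV: "continuous_on V lambda_max"
    using continuous_on_lambda_max by (rule continuous_on_subset) (use V in auto)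
  obtain e where e: "0 < e" "\<And>X. X \<in> V \<inter> sphere 0 1 \<Longrightarrow> e \<le> lambda_max X"
  proof (cases "V \<inter> sphere 0 1 = {}")
    case False
    have "continuous_on (V \<inter> sphere 0 1) lambda_max"
      using contV by (rule continuous_on_subset) simp
    from continuous_attains_inf[OF comp False this] obtain X where
      X: "X \<in> V \<inter> sphere 0 1" "\<And>Y. Y \<in> V \<inter> sphere 0 1 \<Longrightarrow> lambda_max X \<le> lambda_max Y" by blast
    then have "0 < lambda_max X" using pos'[of X] by fastforce
    with X that show ?thesis by blast
  qed (use that[of 1] in auto)
  have coer: "e * norm X \<le> lambda_max (G + X)" if X: "X \<in> V" for X
  proof -
    have hGX: "hermitian (G + X)" using G(1) V(2)[OF X] by (rule hermitian_add)
    show ?thesis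
    proof (cases "X = 0")
      case True
      obtain x where "norm x = 1" "qform G x = lambda_max G" using lambda_max_attained[OF G(1)] .
      then show ?thesis using True G(2)[of x] by simp
    next
      case False
      define Y where "Y = (1 / norm X) *\<^sub>R X"
      have Y: "Y \<in> V \<inter> sphere 0 1" using False X V(1) by (simp add: Y_def subspace_scale)
      obtain x where x: "norm x = 1" "qform Y x = lambda_max Y"
        using lambda_max_attained[OF V(2)] Y by blast
      have "qform Y x = qform X x / norm X" by (simp add: Y_def qform_def matrix_scaleR_left)
      then have "e \<le> qform X x / norm X" using e(2)[OF Y] x by simp
      then have "e * norm X \<le> qform X x" using False by (simp add: field_simps)
      also have "\<dots> \<le> qform (G + X) x" using G(2)[of x] by (simp add: qform_add)
      also have "\<dots> \<le> lambda_max (G + X)" using lambda_max_ge[OF hGX, of x] x by simp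
      finally show ?thesis .
    qed
  qed
  have "continuous_on V (\<lambda>X. lambda_max (G + X))"
    by (rule continuous_on_compose2[OF continuous_on_lambda_max])
       (use V(2) G(1) hermitian_add in \<open>auto intro!: continuous_intros\<close>)
  from coercive_attains_min[OF closed_subspace[OF V(1)] subspace_0[OF V(1)] this e(1) coer] that
  show thesis by blast
qed

section \<open>Block matrices\<close>

text \<open>Vectors over a sum of index types are pairs; block matrices are computed by their action on
  pairs.\<close>

definition vjoin :: "'a^'b \<Rightarrow> 'a^'c \<Rightarrow> 'a^('b + 'c)"
  where "vjoin u v = (\<chi> i. case i of Inl b \<Rightarrow> u $ b | Inr c \<Rightarrow> v $ c)"

lemma vjoin_nth [simp]: "vjoin u v $ Inl b = u $ b" "vjoin u v $ Inr c = v $ c"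
  by (simp_all add: vjoin_def)

lemma vjoin_eq_iff: "z = vjoin u v \<longleftrightarrow> (\<forall>b. z $ Inl b = u $ b) \<and> (\<forall>c. z $ Inr c = v $ c)"
  by (auto simp: vec_eq_iff vjoin_def split: sum.split)

lemma vjoin_cases: obtains u v where "z = vjoin u v"
  using vjoin_eq_iff[of z "\<chi> b. z $ Inl b" "\<chi> c. z $ Inr c"] by auto

lemma vjoin_inject [simp]: "vjoin u v = vjoin u' v' \<longleftrightarrow> u = u' \<and> v = v'"
  unfolding vjoin_eq_iff vjoin_nth by (simp add: vec_eq_iff)

lemma vjoin_add: "vjoin u v + vjoin u' v' = vjoin (u + u') (v + v')"
  and vjoin_smult: "c *s vjoin (x::complex^'b) y = vjoin (c *s x) (c *s y)"
  and vjoin_zero: "0 = vjoin (0::complex^'b) (0::complex^'c)"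
  by (auto simp: vjoin_eq_iff)

lemma sum_Plus_UNIV: "(\<Sum>i\<in>UNIV. f i) = (\<Sum>b\<in>UNIV. f (Inl b)) + (\<Sum>c\<in>UNIV. f (Inr c))"
  for f :: "'b::finite + 'c::finite \<Rightarrow> 'd::comm_monoid_add"
  by (subst UNIV_Plus_UNIV[symmetric], subst sum.Plus) auto

lemma cip_vjoin [simp]: "cip (vjoin u v) (vjoin u' v') = cip u u' + cip v v'"
  by (simp add: cip_def sum_Plus_UNIV)

lemma norm_vjoin: "(norm (vjoin u v :: complex^('b::finite + 'c::finite)))\<^sup>2 = (norm u)\<^sup>2 + (norm v)\<^sup>2"
proof -
  have "complex_of_real ((norm (vjoin u v))\<^sup>2) = complex_of_real ((norm u)\<^sup>2 + (norm v)\<^sup>2)"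
    unfolding cip_self[symmetric] of_real_add by simp
  then show ?thesis by (simp only: of_real_eq_iff)
qed

lemma hcat_vjoin: "hcat A B *v vjoin u v = A *v u + B *v v"
  by (simp add: vec_eq_iff matrix_vector_mult_def hcat_def sum_Plus_UNIV)

lemma vcat_mult: "vcat A B *v x = vjoin (A *v x) (B *v x)"
  by (simp add: vjoin_eq_iff matrix_vector_mult_def vcat_def)

lemma block_mat_vjoin:
  "block_mat A B C D *v vjoin u v = vjoin (A *v u + B *v v) (C *v u + D *v v)"
  by (simp add: block_mat_def vcat_mult hcat_vjoin)

lemma mat_mult_vec [simp]: "mat c *v x = c *s (x::complex^'n)"
  by (simp add: vec_eq_iff matrix_vector_mult_def mat_def if_distrib if_distribR cong: if_cong)

lemma smat_mult_vec [simp]: "(c *\<^sub>C A) *v x = c *s (A *v x)"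
  by (simp add: vec_eq_iff matrix_vector_mult_def smat_def sum_distrib_left mult.assoc)

lemma cnjv_nth [simp]: "cnjv x $ i = cnj (x $ i)" by (simp add: cnjv_def)

lemma cnjv_cnjv [simp]: "cnjv (cnjv x) = x" by (simp add: vec_eq_iff)

lemma norm_cnjv [simp]: "norm (cnjv x) = norm x"
  by (simp add: norm_vec_def cnjv_def)

lemma conj_mat_mult: "conj_mat A *v x = cnjv (A *v cnjv x)"
  by (simp add: vec_eq_iff matrix_vector_mult_def conj_mat_def)

lemma transpose_mult_eq: "transpose A *v x = cnjv (ctranspose A *v cnjv x)"
  by (simp add: vec_eq_iff matrix_vector_mult_def conj_mat_def ctranspose_def transpose_def)

lemma cip_cnjv: "cip (cnjv x) (cnjv y) = cnj (cip x y)"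
  by (simp add: cip_def)

lemma cip_cnjv_commute: "cip (cnjv x) y = cip (cnjv y) x"
  by (simp add: cip_def mult.commute)

text \<open>The bilinear form \<open>x\<^sup>T y\<close> is \<open>cip (cnjv x) y\<close>; with respect to it the transpose is
  the adjoint.\<close>

lemma cip_transpose: "cip (cnjv x) (transpose A *v y) = cip (cnjv (A *v x)) y"
proof -
  have "cip (cnjv x) (transpose A *v y) = cnj (cip x (ctranspose A *v cnjv y))"
    unfolding transpose_mult_eq cip_cnjv ..
  also have "\<dots> = cnj (cip (A *v x) (cnjv y))" by (simp add: cip_matrix)
  also have "\<dots> = cip (cnjv (A *v x)) y" by (simp flip: cip_cnjv)
  finally show ?thesis .
qed

lemma transpose_block_mat:
  "transpose (block_mat A B C D) = block_mat (transpose A) (transpose C) (transpose B) (transpose D)"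
  by (simp add: vec_eq_iff transpose_def block_mat_def vcat_def hcat_def split: sum.split)

lemma transpose_zero [simp]: "transpose (0 :: 'a::zero^'n^'m) = 0"
  by (simp add: transpose_def vec_eq_iff)

lemma matrix_minus_left: "(- X) *v a = - (X *v (a :: complex^'n))"
  by (simp add: vec_eq_iff matrix_vector_mult_def sum_negf)

lemma vjoin_eq_0_iff [simp]: "vjoin u v = (0 :: complex^('b::finite + 'c::finite)) \<longleftrightarrow> u = 0 \<and> v = 0"
  by (subst vjoin_zero) (rule vjoin_inject)

lemma cnjv_vjoin [simp]: "cnjv (vjoin u v) = vjoin (cnjv u) (cnjv v)"
  by (simp add: vjoin_eq_iff)

lemma cnjv_smult [simp]: "cnjv (c *s u) = cnj c *s cnjv u"
  by (simp add: vec_eq_iff)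

lemma cnjv_add [simp]: "cnjv (u + v) = cnjv u + cnjv v"
  and cnjv_diff [simp]: "cnjv (u - v) = cnjv u - cnjv v"
  by (simp_all add: vec_eq_iff)

section \<open>Spectral norm and singular perturbations\<close>

lemma spectral_norm_bound: "norm (D *v x) \<le> spectral_norm D * norm (x::complex^'n)"
  unfolding spectral_norm_def by (rule onorm) simp

lemma spectral_norm_nonneg: "0 \<le> spectral_norm D"
  unfolding spectral_norm_def by (rule onorm_pos_le) simp

lemma spectral_norm_ctranspose_le: "spectral_norm (ctranspose D) \<le> spectral_norm D"
  unfolding spectral_norm_def[of "ctranspose D"]
proof (rule onorm_le)
  fix x
  let ?y = "ctranspose D *v x"
  have "norm ?y * norm ?y = (D *v ?y) \<bullet> x"
    by (simp add: inner_eq_Re_cip cip_matrix_left cip_self power2_eq_square)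
  also have "\<dots> \<le> (spectral_norm D * norm ?y) * norm x"
    using norm_cauchy_schwarz[of "D *v ?y" x] spectral_norm_bound[of D ?y]
    by (meson mult_right_mono norm_ge_zero order_trans)
  finally have "norm ?y * norm ?y \<le> norm ?y * (spectral_norm D * norm x)" by (simp add: ac_simps)
  then show "norm ?y \<le> spectral_norm D * norm x"
    by (cases "?y = 0") (simp_all add: spectral_norm_nonneg)
qed

lemma spectral_norm_transpose_le: "spectral_norm (transpose D) \<le> spectral_norm D"
  unfolding spectral_norm_def[of "transpose D"]
proof (rule onorm_le)
  fix x
  have "norm (transpose D *v x) \<le> spectral_norm (ctranspose D) * norm (cnjv x)"
    unfolding transpose_mult_eq norm_cnjv[of "_ *v _"] by (rule spectral_norm_bound)
  also have "\<dots> \<le> spectral_norm D * norm x"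
    using spectral_norm_ctranspose_le[of D] by (simp add: mult_right_mono)
  finally show "norm (transpose D *v x) \<le> spectral_norm D * norm x" .
qed

lemma spectral_norm_star_mat: "spectral_norm (star_mat st D) = spectral_norm D"
proof (cases st)
  case Star_CT
  then show ?thesis
    using spectral_norm_ctranspose_le[of D] spectral_norm_ctranspose_le[of "ctranspose D"] by simp
next
  case Star_T
  then show ?thesis
    using spectral_norm_transpose_le[of D] spectral_norm_transpose_le[of "transpose D"] by simp
qed

lemma det_zero_matrix: "det (0 :: complex^'n^'n) = 0"
  using det_0 by (simp add: mat_def flip: zero_vec_def)

lemma singular_self: "det (pencil (A - A) (star_mat st A - star_mat st A) s) = 0"
  by (simp add: pencil_def smat_def map_matrix_def det_zero_matrix flip: zero_vec_def)

text \<open>The star of a perturbation has the same spectral norm, whence the factor 2. The infimum is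
  taken over a nonempty set because \<open>D = A\<close> is admissible.\<close>

lemma pal_dist_ge:
  assumes m: "0 < m" and bound: "\<And>D. \<forall>s. det (pencil (A - D) (star_mat st A - star_mat st D) s) = 0
      \<Longrightarrow> 1 \<le> m * (spectral_norm D)\<^sup>2"
  shows "2 * inverse m \<le> (pal_dist st A)\<^sup>2"
proof -
  have "sqrt (2 * inverse m) \<le> pal_dist st A"
    unfolding pal_dist_def
  proof (rule cInf_greatest)
    have "\<forall>s. det (pencil (A - A) (star_mat st A - star_mat st A) s) = 0"
      using singular_self by blast
    then show "{sqrt ((spectral_norm D)\<^sup>2 + (spectral_norm (star_mat st D))\<^sup>2) | D.
        \<forall>s. det (pencil (A - D) (star_mat st A - star_mat st D) s) = 0} \<noteq> {}" by blast
  next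
    fix r assume "r \<in> {sqrt ((spectral_norm D)\<^sup>2 + (spectral_norm (star_mat st D))\<^sup>2) | D.
        \<forall>s. det (pencil (A - D) (star_mat st A - star_mat st D) s) = 0}"
    then obtain D where "r = sqrt ((spectral_norm D)\<^sup>2 + (spectral_norm (star_mat st D))\<^sup>2)"
        "\<forall>s. det (pencil (A - D) (star_mat st A - star_mat st D) s) = 0" by blast
    then have D: "r = sqrt ((spectral_norm D)\<^sup>2 + (spectral_norm D)\<^sup>2)"
        "1 \<le> m * (spectral_norm D)\<^sup>2"
      using bound by (simp_all add: spectral_norm_star_mat)
    then have "2 * inverse m \<le> (spectral_norm D)\<^sup>2 + (spectral_norm D)\<^sup>2"
      using m by (simp add: field_simps)
    with D(1) show "sqrt (2 * inverse m) \<le> r" by simp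
  qed
  then have "(sqrt (2 * inverse m))\<^sup>2 \<le> (pal_dist st A)\<^sup>2" using m by (intro power_mono) auto
  then show ?thesis using m by simp
qed

section \<open>The scaling matrix and the Gram matrix\<close>

lemma matrix_inv_both:
  assumes "invertible A" shows "A ** matrix_inv A = mat 1" "matrix_inv A ** A = mat 1"
  using someI_ex[OF assms[unfolded invertible_def]] by (auto simp: matrix_inv_def)

lemma matrix_inv_eqI:
  assumes "A ** B = mat 1" "B ** A = mat 1" shows "matrix_inv A = B"
proof -
  have "invertible A" using assms by (auto simp: invertible_def)
  then have "matrix_inv A ** A ** B = B" by (simp add: matrix_inv_both)
  then show ?thesis using assms(1) by (simp flip: matrix_mul_assoc)
qed

text \<open>The two diagonal entries of \<open>Gamma_mat\<close>; dividing by the second is where \<open>l \<noteq> 0\<close> enters.\<close>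

definition gam1 :: "complex \<Rightarrow> real" where "gam1 l = sqrt (1 / (1 + cmod l))"
definition gam2 :: "complex \<Rightarrow> real" where "gam2 l = sqrt (cmod l / (1 + cmod l))"

lemma Gamma_vjoin:
  "Gamma_mat l *v vjoin u v = vjoin (of_real (gam1 l) *s u) (of_real (gam2 l) *s v)"
  by (simp add: Gamma_mat_def block_mat_vjoin gam1_def gam2_def)

lemma gam_nonzero: "gam1 l \<noteq> 0" "l \<noteq> 0 \<Longrightarrow> gam2 l \<noteq> 0"
  using norm_ge_zero[of l] by (auto simp: gam1_def gam2_def add_nonneg_eq_0_iff)

lemma Gamma_inv_eq:
  assumes "l \<noteq> 0"
  shows "matrix_inv (Gamma_mat l) = block_mat (mat (of_real (inverse (gam1 l)))) 0
    0 (mat (of_real (inverse (gam2 l))))" (is "_ = ?B")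
proof (rule matrix_inv_eqI)
  note nz = gam_nonzero(1)[of l] gam_nonzero(2)[OF assms]
  have "(Gamma_mat l ** ?B) *v z = mat 1 *v z" for z
    by (cases z rule: vjoin_cases)
      (simp add: block_mat_vjoin Gamma_vjoin vector_smult_assoc nz flip: matrix_vector_mul_assoc of_real_mult)
  then show "Gamma_mat l ** ?B = mat 1" by (simp only: matrix_eq) blast
  have "(?B ** Gamma_mat l) *v z = mat 1 *v z" for z
    by (cases z rule: vjoin_cases)
      (simp add: block_mat_vjoin Gamma_vjoin vector_smult_assoc nz flip: matrix_vector_mul_assoc of_real_mult)
  then show "?B ** Gamma_mat l = mat 1" by (simp only: matrix_eq) blast
qed

lemma Gamma_inv_vjoin:
  assumes "l \<noteq> 0"
  shows "matrix_inv (Gamma_mat l) *v vjoin u v =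
    vjoin (of_real (inverse (gam1 l)) *s u) (of_real (inverse (gam2 l)) *s v)"
  by (simp add: Gamma_inv_eq[OF assms] block_mat_vjoin)

lemma Gamma_inv_Gamma:
  assumes "l \<noteq> 0"
  shows "matrix_inv (Gamma_mat l) *v (Gamma_mat l *v w) = w"
    and "Gamma_mat l *v (matrix_inv (Gamma_mat l) *v w) = w"
  using gam_nonzero(1)[of l] gam_nonzero(2)[OF assms]
  by (cases w rule: vjoin_cases;
      simp add: Gamma_inv_vjoin[OF assms] Gamma_vjoin vector_smult_assoc flip: of_real_mult)+

lemma Gamma_inv_cip:
  assumes "l \<noteq> 0"
  shows "cip x (matrix_inv (Gamma_mat l) *v y) = cip (matrix_inv (Gamma_mat l) *v x) y"
  by (cases x rule: vjoin_cases; cases y rule: vjoin_cases)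
    (simp add: Gamma_inv_vjoin[OF assms])

lemma Gamma_inv_cnjv:
  assumes "l \<noteq> 0"
  shows "matrix_inv (Gamma_mat l) *v cnjv z = cnjv (matrix_inv (Gamma_mat l) *v z)"
  by (cases z rule: vjoin_cases) (simp add: Gamma_inv_vjoin[OF assms])

lemma transpose_Gamma_inv:
  assumes "l \<noteq> 0"
  shows "transpose (matrix_inv (Gamma_mat l)) = matrix_inv (Gamma_mat l)"
  by (simp add: Gamma_inv_eq[OF assms] transpose_block_mat transpose_mat)

text \<open>The weights in \<open>Gamma_mat\<close> are chosen such that their squares add up to 1.\<close>

lemma norm_Gamma_vjoin:
  assumes "norm u \<le> r" "norm v \<le> r"
  shows "(norm (Gamma_mat l *v vjoin u v))\<^sup>2 \<le> r\<^sup>2"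
proof -
  have sq: "(gam1 l)\<^sup>2 = 1 / (1 + cmod l)" "(gam2 l)\<^sup>2 = cmod l / (1 + cmod l)"
    by (simp_all add: gam1_def gam2_def)
  have "(norm (Gamma_mat l *v vjoin u v))\<^sup>2 = (gam1 l)\<^sup>2 * (norm u)\<^sup>2 + (gam2 l)\<^sup>2 * (norm v)\<^sup>2"
    by (simp add: Gamma_vjoin norm_vjoin power_mult_distrib)
  also have "\<dots> \<le> (gam1 l)\<^sup>2 * r\<^sup>2 + (gam2 l)\<^sup>2 * r\<^sup>2"
    using assms by (intro add_mono mult_left_mono power_mono) auto
  also have "\<dots> = ((1 + cmod l) / (1 + cmod l)) * r\<^sup>2"
    unfolding sq add_divide_distrib distrib_right ..
  also have "\<dots> = r\<^sup>2" using add_pos_nonneg[OF zero_less_one norm_ge_zero, of l] by simp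
  finally show ?thesis .
qed

text \<open>If \<open>z = Gamma_mat l (u, v)\<close> then this is \<open>M_mat st A l (u + l v)\<close>. For \<open>u = D x\<close>, \<open>v = D\<^sup>\<star> x\<close> and \<open>x\<close>
  in the kernel of the perturbed pencil at \<open>l\<close> it gives back \<open>x\<close>. The matrix \<open>G_mat\<close> is the Gram
  matrix of this map.\<close>

definition recover :: "star \<Rightarrow> complex^'n^'n \<Rightarrow> complex \<Rightarrow> complex^('n::finite + 'n) \<Rightarrow> complex^'n"
  where "recover st A l z =
    M_mat st A l *v (hcat (mat 1) (mat l) *v (matrix_inv (Gamma_mat l) *v z))"

lemma recover_smult: "recover st A l (c *s z) = c *s recover st A l z"
  by (simp add: recover_def matrix_smult)

lemma G_cip:
  assumes "l \<noteq> 0"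
  shows "cip x (G_mat st A l *v y) = cip (recover st A l x) (recover st A l y)"
proof -
  have h: "cip x (vcat (mat 1) (mat (cnj l)) *v p) = cip (hcat (mat 1) (mat l) *v x) p"
    for x and p :: "complex^'a"
    by (cases x rule: vjoin_cases) (simp add: vcat_mult hcat_vjoin)
  show ?thesis
    by (simp add: G_mat_def Let_def Gamma_inv_cip[OF assms] h recover_def cip_matrix[of _ "ctranspose _"]
        flip: matrix_vector_mul_assoc)
qed

lemma hermitian_G: "l \<noteq> 0 \<Longrightarrow> hermitian (G_mat st A l)"
  by (rule hermitianI) (metis G_cip cip_commute)

lemma qform_eq: "qform H x = Re (cip x (H *v x))"
  by (simp add: qform_def inner_commute flip: inner_eq_Re_cip)

lemma qform_G: "l \<noteq> 0 \<Longrightarrow> qform (G_mat st A l) z = (norm (recover st A l z))\<^sup>2"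
  by (simp add: qform_eq G_cip cip_self)

lemma pencil_mult: "pencil A E s *v x = A *v x + s *s (E *v x)"
  by (simp add: pencil_def matrix_vector_mult_add_rdistrib)

lemma M_mat_inverse:
  assumes "invertible (pencil A (star_mat st A) l)"
  shows "M_mat st A l *v (A *v x + l *s (star_mat st A *v x)) = x"
    and "A *v (M_mat st A l *v x) + l *s (star_mat st A *v (M_mat st A l *v x)) = x"
  using matrix_inv_both[OF assms] unfolding M_mat_def pencil_mult[symmetric]
  by (simp_all only: matrix_vector_mul_assoc matrix_vector_mul_lid)

text \<open>The test vector of both lower bounds. A kernel vector \<open>x\<close> of the perturbed pencil at \<open>l\<close>
  satisfies \<open>L(l) x = D x + l D\<^sup>\<star> x\<close>; the scaled pair \<open>z\<close> of the images of \<open>x\<close> determines \<open>x\<close> and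
  is at most \<open>spectral_norm D\<close> times as long. By \<open>qform_G\<close>, the Rayleigh quotient of \<open>G_mat\<close> at
  \<open>z\<close> is thus at least the inverse square of \<open>spectral_norm D\<close>.\<close>

lemma singular_perturbation_vector:
  fixes A D :: "complex^'n^'n"
  assumes l: "l \<noteq> 0" and inv: "invertible (pencil A (star_mat st A) l)"
    and sing: "det (pencil (A - D) (star_mat st A - star_mat st D) l) = 0"
  obtains x z where "x \<noteq> 0" "z = Gamma_mat l *v vjoin (D *v x) (star_mat st D *v x)"
    "z \<noteq> 0" "recover st A l z = x" "(norm z)\<^sup>2 \<le> (spectral_norm D)\<^sup>2 * (norm x)\<^sup>2"
proof -
  let ?P = "pencil (A - D) (star_mat st A - star_mat st D) l"
  have "\<not> invertible ?P" using sing by (simp add: invertible_det_nz)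
  then obtain x where x: "x \<noteq> 0" "?P *v x = 0"
    using matrix_left_invertible_ker[of ?P] by (auto simp: invertible_left_inverse)
  let ?w = "vjoin (D *v x) (star_mat st D *v x)"
  define z where "z = Gamma_mat l *v ?w"
  have "A *v x + l *s (star_mat st A *v x) = D *v x + l *s (star_mat st D *v x)"
    using x(2) by (simp add: pencil_mult matrix_vector_mult_diff_rdistrib vector_ssub_ldistrib algebra_simps)
  then have "recover st A l z = M_mat st A l *v (A *v x + l *s (star_mat st A *v x))"
    by (simp add: z_def recover_def Gamma_inv_Gamma[OF l] hcat_vjoin)
  then have rec: "recover st A l z = x" by (simp add: M_mat_inverse[OF inv])
  then have "z \<noteq> 0" using x(1) by (auto simp: recover_def)
  moreover have "(norm z)\<^sup>2 \<le> (spectral_norm D * norm x)\<^sup>2"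
    unfolding z_def
    using spectral_norm_bound[of D x] spectral_norm_bound[of "star_mat st D" x]
    by (intro norm_Gamma_vjoin) (auto simp: spectral_norm_star_mat)
  ultimately show thesis using that[OF x(1) z_def _ rec] by (simp add: power_mult_distrib)
qed

section \<open>The conjugate transpose case\<close>

lemma ctranspose_smat_mult: "ctranspose (c *\<^sub>C A) *v x = cnj c *s (ctranspose A *v x)"
  by (simp add: vec_eq_iff matrix_vector_mult_def smat_def ctranspose_def conj_mat_def
      transpose_def sum_distrib_left mult.assoc)

lemma C_CT_form:
  "cip (vjoin u v) (C_mat Star_CT A l *v vjoin u v) =
    cip (M_mat Star_CT A l *v (u + l *s v)) u - cip v (M_mat Star_CT A l *v (u + l *s v))"
  by (simp add: C_mat_def Let_def block_mat_vjoin ctranspose_smat_mult matrix_minus_left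
      matrix_vector_mult_diff_rdistrib matrix_vector_right_distrib matrix_smult
      cip_matrix[of _ "ctranspose _"] algebra_simps)

text \<open>With \<open>c = t1 + \<i> t2\<close>, the combination of \<open>H1_mat\<close> and \<open>H2_mat\<close> is the scaled Hermitian
  matrix \<open>c C + (c C)\<^sup>*\<close>. The two real parameters are the multiplier for one complex
  constraint.\<close>

lemma H_cip:
  fixes A :: "complex^'n^'n"
  assumes "l \<noteq> 0"
  defines "W \<equiv> matrix_inv (Gamma_mat l)" and "C \<equiv> C_mat Star_CT A l"
  shows "cip x ((t1 *\<^sub>R H1_mat A l + t2 *\<^sub>R H2_mat A l) *v y) =
    Complex t1 t2 * cip (W *v x) (C *v (W *v y))
    + cnj (Complex t1 t2) * cip (C *v (W *v x)) (W *v y)"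
proof -
  have c: "Complex t1 t2 = of_real t1 + \<i> * of_real t2" by (simp add: complex_eq_iff)
  have H1: "cip x (H1_mat A l *v y) = cip (W *v x) (C *v (W *v y)) + cip (C *v (W *v x)) (W *v y)"
    by (simp add: Gamma_inv_cip[OF assms(1)] H1_mat_def Let_def W_def C_def matrix_vector_mult_add_rdistrib cip_matrix[of _ "ctranspose _"]
        flip: matrix_vector_mul_assoc)
  have H2: "cip x (H2_mat A l *v y) = \<i> * (cip (W *v x) (C *v (W *v y)) - cip (C *v (W *v x)) (W *v y))"
    by (simp add: Gamma_inv_cip[OF assms(1)] H2_mat_def Let_def W_def C_def matrix_vector_mult_diff_rdistrib cip_matrix[of _ "ctranspose _"]
        flip: matrix_vector_mul_assoc)
  show ?thesis
    by (simp add: matrix_vector_mult_add_rdistrib matrix_scaleR_left H1 H2 c algebra_simps)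
qed

lemma hermitian_H:
  assumes "l \<noteq> 0" shows "hermitian (t1 *\<^sub>R H1_mat A l + t2 *\<^sub>R H2_mat A l)"
proof (rule hermitianI)
  fix x y
  let ?H = "t1 *\<^sub>R H1_mat A l + t2 *\<^sub>R H2_mat A l"
  have "cip (?H *v x) y = cnj (cip y (?H *v x))" by (rule cip_commute)
  also have "\<dots> = cip x (?H *v y)"
    unfolding H_cip[OF assms] by (simp flip: cip_commute)
  finally show "cip x (?H *v y) = cip (?H *v x) y" ..
qed

lemma qform_H:
  assumes "l \<noteq> 0" and w: "matrix_inv (Gamma_mat l) *v z = w"
  shows "qform (t1 *\<^sub>R H1_mat A l + t2 *\<^sub>R H2_mat A l) z =
    2 * Re (Complex t1 t2 * cip w (C_mat Star_CT A l *v w))"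
proof -
  have "cip (C_mat Star_CT A l *v w) w = cnj (cip w (C_mat Star_CT A l *v w))"
    by (rule cip_commute)
  then show ?thesis unfolding qform_eq H_cip[OF assms(1)] w by simp
qed

text \<open>The pair \<open>u = D x\<close>, \<open>v = D\<^sup>* x\<close> satisfies \<open>x\<^sup>* u = v\<^sup>* x\<close>, so the form of every combination of
  \<open>H1_mat\<close> and \<open>H2_mat\<close> vanishes at the test vector, and only that of \<open>G_mat\<close> remains.\<close>

lemma CT_bound:
  fixes A D :: "complex^'n^'n" and t1 t2 :: real
  assumes l: "l \<noteq> 0" and inv: "invertible (pencil A (star_mat Star_CT A) l)"
    and sing: "det (pencil (A - D) (star_mat Star_CT A - star_mat Star_CT D) l) = 0"
  defines "m \<equiv> lambda_max (G_mat Star_CT A l + t1 *\<^sub>R H1_mat A l + t2 *\<^sub>R H2_mat A l)"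
  shows "0 < m" and "1 \<le> m * (spectral_norm D)\<^sup>2"
proof -
  obtain x z where x: "x \<noteq> 0" "z = Gamma_mat l *v vjoin (D *v x) (star_mat Star_CT D *v x)"
    "z \<noteq> 0" "recover Star_CT A l z = x" "(norm z)\<^sup>2 \<le> (spectral_norm D)\<^sup>2 * (norm x)\<^sup>2"
    using singular_perturbation_vector[OF l inv sing] .
  let ?u = "D *v x" and ?v = "star_mat Star_CT D *v x"
  let ?H = "t1 *\<^sub>R H1_mat A l + t2 *\<^sub>R H2_mat A l"
  have w: "matrix_inv (Gamma_mat l) *v z = vjoin ?u ?v"
    by (simp only: x(2) Gamma_inv_Gamma[OF l])
  have Mx: "M_mat Star_CT A l *v (?u + l *s ?v) = x"
    using x(4) by (simp add: recover_def w hcat_vjoin)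
  have "cip (vjoin ?u ?v) (C_mat Star_CT A l *v vjoin ?u ?v) = 0"
    unfolding C_CT_form Mx by (simp add: cip_matrix)
  then have "qform ?H z = 0" by (simp add: qform_H[OF l w])
  then have "(norm x)\<^sup>2 = qform (G_mat Star_CT A l + ?H) z"
    by (simp add: qform_add qform_G[OF l] x(4))
  also have "\<dots> \<le> m * (norm z)\<^sup>2"
    unfolding m_def add.assoc
    by (intro lambda_max_ge hermitian_add hermitian_G hermitian_H l)
  finally have le: "(norm x)\<^sup>2 \<le> m * (norm z)\<^sup>2" .
  have "0 < (norm x)\<^sup>2" using x(1) by simp
  with le show "0 < m" by (smt (verit) zero_le_power2 mult_nonpos_nonneg)
  then have "m * (norm z)\<^sup>2 \<le> m * ((spectral_norm D)\<^sup>2 * (norm x)\<^sup>2)"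
    using x(5) by simp
  with le have "1 * (norm x)\<^sup>2 \<le> (m * (spectral_norm D)\<^sup>2) * (norm x)\<^sup>2" by (simp add: mult.assoc)
  then show "1 \<le> m * (spectral_norm D)\<^sup>2" using x(1) by (simp only: mult_le_cancel_right) simp
qed

text \<open>In the coordinates \<open>x = M (u + l v)\<close> and \<open>v\<close>, with \<open>c = t1 + \<i> t2\<close>, the form at \<open>(u, v)\<close>
  is twice the real part of \<open>d (cnj (x\<^sup>* A x) - x\<^sup>* v)\<close> where \<open>d = c l + cnj c\<close>. For \<open>d = 0\<close>,
  which with \<open>c \<noteq> 0\<close> occurs only if \<open>l\<close> has modulus 1, it vanishes identically. For \<open>d \<noteq> 0\<close> the product
  \<open>x\<^sup>* v\<close> can be prescribed at will.\<close>

lemma H_combination_zero_or_positive: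
  fixes A :: "complex^'n^'n"
  assumes l: "l \<noteq> 0" and inv: "invertible (pencil A (star_mat Star_CT A) l)"
    and nz: "t1 *\<^sub>R H1_mat A l + t2 *\<^sub>R H2_mat A l \<noteq> 0"
  shows "\<exists>z. 0 < qform (t1 *\<^sub>R H1_mat A l + t2 *\<^sub>R H2_mat A l) z"
proof -
  let ?H = "t1 *\<^sub>R H1_mat A l + t2 *\<^sub>R H2_mat A l"
  define c where "c = Complex t1 t2"
  define d where "d = c * l + cnj c"
  define g where "g x = cip x (A *v x)" for x
  have form: "qform ?H (Gamma_mat l *v vjoin u v) = 2 * Re (d * (cnj (g x) - cip x v))"
    if u: "u = A *v x + l *s (ctranspose A *v x) - l *s v" for u v x
  proof -
    have Mx: "M_mat Star_CT A l *v (u + l *s v) = x"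
      using M_mat_inverse(1)[OF inv, of x] by (simp add: u)
    have "cip x (ctranspose A *v x) = cnj (g x)"
      by (simp add: g_def cip_matrix[of _ "ctranspose _"] flip: cip_commute)
    then have "cip x u = g x + l * cnj (g x) - l * cip x v"
      by (simp add: u g_def)
    moreover have "cip v x = cnj (cip x v)" by (rule cip_commute)
    ultimately have "cip (vjoin u v) (C_mat Star_CT A l *v vjoin u v) =
        g x + l * cnj (g x) - l * cip x v - cnj (cip x v)"
      unfolding C_CT_form Mx by simp
    then have "qform ?H (Gamma_mat l *v vjoin u v) =
        2 * Re (c * (g x + l * cnj (g x) - l * cip x v - cnj (cip x v)))"
      by (simp only: qform_H[OF l Gamma_inv_Gamma(1)[OF l]] c_def)
    also have "\<dots> = 2 * Re (d * (cnj (g x) - cip x v))"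
      by (simp add: d_def algebra_simps)
    finally show ?thesis .
  qed
  have "d \<noteq> 0"
  proof
    assume d: "d = 0"
    have "qform ?H z = 0" for z
    proof -
      obtain u v where uv: "matrix_inv (Gamma_mat l) *v z = vjoin u v" by (rule vjoin_cases)
      have z: "z = Gamma_mat l *v vjoin u v" by (simp flip: uv add: Gamma_inv_Gamma[OF l])
      let ?x = "M_mat Star_CT A l *v (u + l *s v)"
      have "u = A *v ?x + l *s (ctranspose A *v ?x) - l *s v"
        using M_mat_inverse(2)[OF inv, of "u + l *s v"] by (simp add: algebra_simps)
      from form[OF this] show ?thesis by (simp only: z d) simp
    qed
    then show False using nz hermitian_zero_if_form_zero hermitian_H[OF l] by blast
  qed
  define x :: "complex^'n" where "x = axis undefined 1"
  have x: "cip x x = 1" by (simp add: cip_def x_def axis_def if_distrib if_distribR cong: if_cong)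
  \<comment> \<open>This makes \<open>cnj (g x) - cip x v\<close> equal to \<open>cnj d\<close>.\<close>
  define v where "v = (cnj (g x) - cnj d) *s x"
  have "qform ?H (Gamma_mat l *v vjoin (A *v x + l *s (ctranspose A *v x) - l *s v) v)
      = 2 * Re (d * cnj d)"
    unfolding form[OF refl] by (simp add: v_def x)
  moreover have "0 < Re (d * cnj d)"
    using \<open>d \<noteq> 0\<close> by (simp add: complex_mult_cnj sum_power2_gt_zero_iff complex_eq_iff)
  ultimately show ?thesis by (metis mult_pos_pos zero_less_numeral)
qed

lemma CT_attains_min:
  fixes A :: "complex^'n^'n"
  assumes l: "l \<noteq> 0" and inv: "invertible (pencil A (star_mat Star_CT A) l)"
  shows "\<exists>m. is_minimum m {lambda_max (G_mat Star_CT A l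
    + t1 *\<^sub>R H1_mat A l + t2 *\<^sub>R H2_mat A l) | t1 t2. True}"
proof -
  define h where "h t1 t2 = t1 *\<^sub>R H1_mat A l + t2 *\<^sub>R H2_mat A l" for t1 t2
  define V where "V = {h t1 t2 | t1 t2. True}"
  have V: "subspace V"
    unfolding subspace_def
  proof (intro conjI ballI allI)
    show "0 \<in> V" by (auto simp: V_def h_def intro!: exI[of _ "0::real"])
    show "X + Y \<in> V" if XY: "X \<in> V" "Y \<in> V" for X Y
    proof -
      obtain a b c d where "X = h a b" "Y = h c d" using XY by (auto simp: V_def)
      then have "X + Y = h (a + c) (b + d)" by (simp add: h_def algebra_simps)
      then show ?thesis by (auto simp: V_def)
    qed
    show "r *\<^sub>R X \<in> V" if X: "X \<in> V" for r X
    proof -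
      obtain a b where "X = h a b" using X by (auto simp: V_def)
      then have "r *\<^sub>R X = h (r * a) (r * b)" by (simp add: h_def algebra_simps)
      then show ?thesis by (auto simp: V_def)
    qed
  qed
  have "hermitian X" if "X \<in> V" for X
    using that hermitian_H[OF l] by (auto simp: V_def h_def)
  moreover have "\<exists>z. 0 < qform X z" if "X \<in> V" "X \<noteq> 0" for X
    using that H_combination_zero_or_positive[OF l inv] by (auto simp: V_def h_def)
  moreover have "0 \<le> qform (G_mat Star_CT A l) z" for z by (simp add: qform_G[OF l])
  ultimately obtain X where X: "X \<in> V"
      "\<And>Y. Y \<in> V \<Longrightarrow> lambda_max (G_mat Star_CT A l + X) \<le> lambda_max (G_mat Star_CT A l + Y)"
    using lambda_max_subspace_attains_min[OF hermitian_G[OF l] _ V] by metis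
  have eq: "{lambda_max (G_mat Star_CT A l + t1 *\<^sub>R H1_mat A l + t2 *\<^sub>R H2_mat A l) | t1 t2. True}
      = (\<lambda>Y. lambda_max (G_mat Star_CT A l + Y)) ` V"
    by (auto simp: V_def h_def add.assoc)
  show ?thesis
    unfolding eq is_minimum_def
    by (intro exI[of _ "lambda_max (G_mat Star_CT A l + X)"]) (use X in auto)
qed

section \<open>The transpose case\<close>

lemma transpose_add: "transpose (A + B) = transpose A + transpose (B :: complex^'n^'m)"
  by (simp add: transpose_def vec_eq_iff)

lemma smat_transpose: "transpose (c *\<^sub>C A) = c *\<^sub>C transpose A"
  by (simp add: transpose_def smat_def vec_eq_iff)

lemma C_T_symmetric_part:
  fixes A :: "complex^'n^'n" and u v :: "complex^'n" and l :: complex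
  defines "M \<equiv> M_mat Star_T A l"
  defines "x \<equiv> M *v (u + l *s v)" and "y \<equiv> transpose M *v (u - v)"
  shows "(C_mat Star_T A l + transpose (C_mat Star_T A l)) *v vjoin u v = vjoin (x + y) (l *s y - x)"
proof -
  have [simp]: "transpose (X - Y) = transpose X - transpose Y" "transpose (- X) = - transpose X"
 for X Y :: "complex^'n^'n"
    by (simp_all add: transpose_def vec_eq_iff)
  show ?thesis
    by (simp add: C_mat_def Let_def transpose_block_mat matrix_vector_mult_add_rdistrib
        block_mat_vjoin vjoin_add matrix_minus_left x_def y_def M_def smat_transpose matrix_vector_mult_diff_rdistrib
        matrix_vector_right_distrib matrix_vector_mult_diff_distrib matrix_smult
        vector_ssub_ldistrib vector_add_ldistrib algebra_simps)
qed

lemma S_mult: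
  "S_mat A l *v z = matrix_inv (Gamma_mat l) *v ((C_mat Star_T A l + transpose (C_mat Star_T A l))
      *v (matrix_inv (Gamma_mat l) *v z))"
  by (simp add: S_mat_def Let_def flip: matrix_vector_mul_assoc)

lemma transpose_S:
  assumes "l \<noteq> 0" shows "transpose (S_mat A l) = S_mat A l"
  by (simp add: S_mat_def Let_def matrix_transpose_mul transpose_Gamma_inv[OF assms] transpose_add
      matrix_mul_assoc add.commute)

lemma conj_S:
  assumes "l \<noteq> 0" shows "conj_mat (S_mat A l) = ctranspose (S_mat A l)"
proof -
  have "ctranspose (S_mat A l) = conj_mat (transpose (S_mat A l))"
    by (simp add: ctranspose_def conj_mat_def transpose_def vec_eq_iff)
  then show ?thesis by (simp add: transpose_S[OF assms])
qed

text \<open>For \<open>u = D x\<close> and \<open>v = D\<^sup>T x\<close> the right-hand side is \<open>2 (x\<^sup>T D x - x\<^sup>T D\<^sup>T x) = 0\<close>.\<close>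

lemma S_bilinear:
  assumes l: "l \<noteq> 0" and w: "matrix_inv (Gamma_mat l) *v z = vjoin u v"
  shows "cip (cnjv z) (S_mat A l *v z) =
    2 * cip (cnjv (M_mat Star_T A l *v (u + l *s v))) (u - v)"
proof -
  let ?M = "M_mat Star_T A l"
  let ?x = "?M *v (u + l *s v)" and ?y = "transpose ?M *v (u - v)"
  have "cip (cnjv z) (S_mat A l *v z) = cip (vjoin (cnjv u) (cnjv v)) (vjoin (?x + ?y) (l *s ?y - ?x))"
    by (simp only: S_mult Gamma_inv_cip[OF l] Gamma_inv_cnjv[OF l] w C_T_symmetric_part cnjv_vjoin)
  also have "\<dots> = cip (cnjv (u - v)) ?x + cip (cnjv (u + l *s v)) ?y"
    by (simp add: algebra_simps)
  also have "cip (cnjv (u - v)) ?x = cip (cnjv ?x) (u - v)" by (rule cip_cnjv_commute)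
  also have "cip (cnjv (u + l *s v)) ?y = cip (cnjv ?x) (u - v)" by (rule cip_transpose)
  finally show ?thesis by simp
qed

text \<open>By \<open>C_T_symmetric_part\<close>, the kernel of \<open>S_mat\<close> is described by \<open>x + y = 0\<close> and \<open>l y = x\<close>, which
  forces \<open>x = y = 0\<close> and then \<open>u = v = 0\<close> unless \<open>l = -1\<close>. For \<open>l = -1\<close> the pencil takes the
  skew-symmetric value \<open>A - A\<^sup>T\<close>; its inverse is skew as well, so \<open>x + y = 0\<close> always.\<close>

lemma S_zero_or_injective:
  fixes A :: "complex^'n^'n"
  assumes l: "l \<noteq> 0" and inv: "invertible (pencil A (star_mat Star_T A) l)"
  shows "S_mat A l = 0 \<or> (\<forall>z. S_mat A l *v z = 0 \<longrightarrow> z = 0)"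
proof (cases "l = -1")
  case True
  let ?M = "M_mat Star_T A l"
  let ?P = "pencil A (transpose A) l"
  have "transpose ?P = - ?P"
    using True by (simp add: pencil_def smat_def transpose_def vec_eq_iff)
  have PM: "?P ** ?M = mat 1" using matrix_inv_both(1)[OF inv] by (simp add: M_mat_def)
  have "transpose ?M ** transpose ?P = mat 1"
    using PM by (metis matrix_transpose_mul transpose_mat)
  then have "transpose ?M ** (- ?P) ** ?M = ?M" by (simp add: \<open>transpose ?P = - ?P\<close>)
  moreover have "transpose ?M ** (- ?P) ** ?M = - transpose ?M"
  proof -
    have "(- ?P) ** ?M = - (mat 1)"
      by (simp flip: PM add: matrix_matrix_mult_def vec_eq_iff sum_negf)
    moreover have "X ** (- mat 1) = - X" for X :: "complex^'n^'n"
      by (simp add: matrix_matrix_mult_def vec_eq_iff mat_def sum_negf if_distrib cong: if_cong)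
    ultimately show ?thesis by (simp flip: matrix_mul_assoc)
  qed
  ultimately have skew: "transpose ?M = - ?M" by (metis add.inverse_inverse)
  have "S_mat A l *v z = 0" for z
  proof -
    obtain u v where uv: "matrix_inv (Gamma_mat l) *v z = vjoin u v" by (rule vjoin_cases)
    have "?M *v (u + l *s v) + transpose ?M *v (u - v) = 0"
      "l *s (transpose ?M *v (u - v)) - ?M *v (u + l *s v) = 0"
      by (simp_all add: True skew[unfolded True] matrix_minus_left)
    then show ?thesis
      unfolding S_mult uv C_T_symmetric_part by (simp flip: vjoin_zero del: vjoin_eq_0_iff)
  qed
  then show ?thesis by (simp add: matrix_eq)
next
  case False
  then have l1: "1 + l \<noteq> 0" by (simp add: add_eq_0_iff)
  let ?M = "M_mat Star_T A l"
  have Minj: "a = 0" if "?M *v a = 0" for a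
    using M_mat_inverse(2)[OF inv, of a] that by simp
  have MP: "?M ** pencil A (transpose A) l = mat 1"
    using matrix_inv_both(2)[OF inv] by (simp add: M_mat_def)
  have "transpose (pencil A (transpose A) l) ** transpose ?M = mat 1"
    using MP by (metis matrix_transpose_mul transpose_mat)
  then have MTinj: "a = 0" if "transpose ?M *v a = 0" for a
    using that by (metis matrix_left_invertible_ker)
  have "z = 0" if S0: "S_mat A l *v z = 0" for z
  proof -
    obtain u v where uv: "matrix_inv (Gamma_mat l) *v z = vjoin u v" by (rule vjoin_cases)
    let ?x = "?M *v (u + l *s v)" and ?y = "transpose ?M *v (u - v)"
    have "vjoin (?x + ?y) (l *s ?y - ?x) = Gamma_mat l *v (S_mat A l *v z)"
      by (simp only: S_mult uv C_T_symmetric_part Gamma_inv_Gamma[OF l])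
    also have "\<dots> = vjoin 0 0" by (simp add: S0)
    finally have xy: "?x = - ?y" "?x = l *s ?y" by (simp_all add: add_eq_0_iff2)
    then have "l *s ?y = - ?y" by simp
    then have "(1 + l) *s ?y = 0" by (simp add: vector_sadd_rdistrib)
    then have y: "?y = 0" using l1 vec.scale_eq_0_iff by blast
    then have "u = v" using MTinj by force
    have "?x = 0" using xy(1) y by simp
    then have "u + l *s v = 0" by (rule Minj)
    then have "(1 + l) *s v = 0" using \<open>u = v\<close> by (simp add: vector_sadd_rdistrib)
    then have "v = 0" using l1 vec.scale_eq_0_iff by blast
    with \<open>u = v\<close> have "vjoin u v = 0" by simp
    then have "Gamma_mat l *v (matrix_inv (Gamma_mat l) *v z) = 0"
      unfolding uv by (simp only: matrix_vector_mult_0_right)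
    then show ?thesis by (simp add: Gamma_inv_Gamma[OF l])
  qed
  then show ?thesis by blast
qed

lemma T_block_vjoin:
  "T_block A l t *v vjoin p q =
    vjoin (G_mat Star_T A l *v p + t *\<^sub>R (conj_mat (S_mat A l) *v q))
      (t *\<^sub>R (S_mat A l *v p) + conj_mat (G_mat Star_T A l) *v q)"
  by (simp add: T_block_def Let_def block_mat_vjoin matrix_scaleR_left)

lemma hermitian_conj_mat: "hermitian H \<Longrightarrow> hermitian (conj_mat H)"
  by (simp add: hermitian_def ctranspose_def conj_mat_def transpose_def vec_eq_iff)

lemma qform_conj_mat: "qform (conj_mat H) x = qform H (cnjv x)"
proof -
  have "cip x (conj_mat H *v x) = cip (cnjv (cnjv x)) (cnjv (H *v cnjv x))"
    by (simp add: conj_mat_mult)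
  also have "\<dots> = cnj (cip (cnjv x) (H *v cnjv x))" by (rule cip_cnjv)
  finally show ?thesis by (simp add: qform_eq)
qed

lemma hermitian_T_block:
  fixes A :: "complex^'n^'n"
  assumes l: "l \<noteq> 0" shows "hermitian (T_block A l t)"
proof (rule hermitianI)
  fix x y :: "complex^(('n + 'n) + ('n + 'n))"
  have G: "ctranspose (G_mat Star_T A l) = G_mat Star_T A l"
    "ctranspose (conj_mat (G_mat Star_T A l)) = conj_mat (G_mat Star_T A l)"
    using hermitian_G[OF l] hermitian_conj_mat by (auto simp: hermitian_def)
  obtain p q where x: "x = vjoin p q" by (rule vjoin_cases)
  obtain p' q' where y: "y = vjoin p' q'" by (rule vjoin_cases)
  show "cip x (T_block A l t *v y) = cip (T_block A l t *v x) y"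
    by (simp add: x y T_block_vjoin conj_S[OF l] cip_matrix G)
qed

lemma qform_T_block:
  assumes l: "l \<noteq> 0"
  shows "qform (T_block A l t) (vjoin p q) = qform (G_mat Star_T A l) p
    + qform (G_mat Star_T A l) (cnjv q) + 2 * t * Re (cip q (S_mat A l *v p))"
proof -
  have "cip p (conj_mat (S_mat A l) *v q) = cnj (cip q (S_mat A l *v p))"
    by (simp add: conj_S[OF l] flip: cip_matrix_left cip_commute)
  moreover have "Re (cip q (conj_mat (G_mat Star_T A l) *v q)) = qform (G_mat Star_T A l) (cnjv q)"
    by (simp only: qform_eq[symmetric] qform_conj_mat)
  ultimately show ?thesis
    by (simp add: qform_eq[of "T_block A l t"] qform_eq[of _ p] T_block_vjoin)
qed

text \<open>Since \<open>z\<^sup>T S z = 0\<close> for the test vector \<open>z\<close>, the off-diagonal blocks contribute nothing on the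
  plane of the pairs \<open>(a z, b cnjv z)\<close>, where the Rayleigh quotient is constant, equal to that of
  \<open>G_mat\<close> at \<open>z\<close>.\<close>

lemma T_bound:
  fixes A D :: "complex^'n^'n" and t :: real
  assumes l: "l \<noteq> 0" and inv: "invertible (pencil A (star_mat Star_T A) l)"
    and sing: "det (pencil (A - D) (star_mat Star_T A - star_mat Star_T D) l) = 0"
  defines "m \<equiv> lambda_2 (T_block A l t)"
  shows "0 < m" and "1 \<le> m * (spectral_norm D)\<^sup>2"
proof -
  obtain x z where x: "x \<noteq> 0" "z = Gamma_mat l *v vjoin (D *v x) (star_mat Star_T D *v x)"
    "z \<noteq> 0" "recover Star_T A l z = x" "(norm z)\<^sup>2 \<le> (spectral_norm D)\<^sup>2 * (norm x)\<^sup>2"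
    using singular_perturbation_vector[OF l inv sing] .
  let ?u = "D *v x" and ?v = "transpose D *v x"
  have w: "matrix_inv (Gamma_mat l) *v z = vjoin ?u ?v"
    by (simp add: x(2) Gamma_inv_Gamma[OF l])
  have Mx: "M_mat Star_T A l *v (?u + l *s ?v) = x"
    using x(4) by (simp add: recover_def w hcat_vjoin)
  have "cip (cnjv x) ?u = cip (cnjv x) ?v"
    by (simp add: cip_transpose cip_cnjv_commute[of x])
  then have S0: "cip (cnjv z) (S_mat A l *v z) = 0"
    unfolding S_bilinear[OF l w] Mx by simp
  define c where "c = (norm x)\<^sup>2 / (norm z)\<^sup>2"
  have "c * (norm (a *s vjoin z 0 + b *s vjoin 0 (cnjv z)))\<^sup>2
      \<le> qform (T_block A l t) (a *s vjoin z 0 + b *s vjoin 0 (cnjv z))" for a b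
  proof -
    have e: "a *s vjoin z 0 + b *s vjoin 0 (cnjv z) = vjoin (a *s z) (b *s cnjv z)"
      by (simp add: vjoin_smult vjoin_add)
    have "cnjv (b *s cnjv z) = cnj b *s z" by (simp add: vec_eq_iff)
    then have "qform (T_block A l t) (vjoin (a *s z) (b *s cnjv z))
        = ((cmod a)\<^sup>2 + (cmod b)\<^sup>2) * (norm x)\<^sup>2"
      by (simp add: qform_T_block[OF l] qform_G[OF l] recover_smult x(4) matrix_smult S0
          power_mult_distrib distrib_right)
    moreover have "(norm (vjoin (a *s z) (b *s cnjv z)))\<^sup>2 = ((cmod a)\<^sup>2 + (cmod b)\<^sup>2) * (norm z)\<^sup>2"
      by (simp add: norm_vjoin power_mult_distrib distrib_right)
    ultimately show ?thesis using x(3) by (simp add: e c_def)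
  qed
  moreover have "indep2 (vjoin z 0) (vjoin 0 (cnjv z))"
  proof (rule indep2_orthogonal)
    have "cnjv z \<noteq> 0" using x(3) norm_cnjv[of z] by force
    then show "vjoin 0 (cnjv z) \<noteq> 0" "vjoin z 0 \<noteq> 0" using x(3) by simp_all
  qed simp
  ultimately have "plane_bound (T_block A l t) c" unfolding plane_bound_def by blast
  then have cm: "c \<le> m" unfolding m_def by (rule lambda_2_ge[OF hermitian_T_block[OF l]])
  have "0 < c" using x(1,3) by (simp add: c_def)
  with cm show m: "0 < m" by simp
  have "(norm x)\<^sup>2 \<le> m * (norm z)\<^sup>2" using cm x(3) by (simp add: c_def field_simps)
  also have "\<dots> \<le> m * ((spectral_norm D)\<^sup>2 * (norm x)\<^sup>2)" using x(5) m by simp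
  finally have "1 * (norm x)\<^sup>2 \<le> (m * (spectral_norm D)\<^sup>2) * (norm x)\<^sup>2" by (simp add: mult.assoc)
  then show "1 \<le> m * (spectral_norm D)\<^sup>2" using x(1) by (simp only: mult_le_cancel_right) simp
qed

text \<open>On the graph of \<open>S\<close>, whose dimension is twice the order of \<open>A\<close> and so at least two, the off-diagonal
  part of the form is \<open>2 t\<close> times the squared norm of \<open>S p\<close>, and injectivity of \<open>S\<close> bounds this
  below by a multiple of the squared norm of \<open>(p, S p)\<close>.\<close>

lemma T_coercive:
  fixes A :: "complex^'n^'n"
  assumes l: "l \<noteq> 0" and inj: "\<And>z. S_mat A l *v z = 0 \<Longrightarrow> z = 0"
  obtains e where "0 < e" "\<And>t. 0 \<le> t \<Longrightarrow> e * t \<le> lambda_2 (T_block A l t)"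
proof -
  let ?S = "S_mat A l"
  have "inj ((*v) ?S)"
  proof (rule injI)
    fix x y assume "?S *v x = ?S *v y"
    then have "?S *v (x - y) = 0" by (simp add: matrix_vector_mult_diff_distrib)
    then show "x = y" using inj[of "x - y"] by simp
  qed
  then obtain B where B: "0 < B" "\<And>x. B * norm x \<le> norm (?S *v x)"
    using linear_inj_bounded_below_pos[OF matrix_vector_mul_linear] by blast
  define e where "e = 2 / (1 / B\<^sup>2 + 1)"
  have k: "0 < 1 / B\<^sup>2 + 1" by (simp add: add_nonneg_pos)
  have "e * t \<le> lambda_2 (T_block A l t)" if t: "0 \<le> t" for t
  proof (rule lambda_2_ge[OF hermitian_T_block[OF l]])
    let ?p = "axis (Inl undefined) 1 :: complex^('n + 'n)"
      and ?q = "axis (Inr undefined) 1 :: complex^('n + 'n)"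
    let ?j = "\<lambda>p. vjoin p (?S *v p)"
    have comb: "a *s ?j p + b *s ?j q = ?j (a *s p + b *s q)" for a b p q
      by (simp add: vjoin_smult vjoin_add matrix_vector_right_distrib matrix_smult)
    have "indep2 ?p ?q" by (rule indep2_axis) simp
    then have ind: "indep2 (?j ?p) (?j ?q)"
      unfolding indep2_def comb by auto
    have "(e * t) * (norm (?j p))\<^sup>2 \<le> qform (T_block A l t) (?j p)" for p
    proof -
      have "(B * norm p)\<^sup>2 \<le> (norm (?S *v p))\<^sup>2" using B by (intro power_mono) auto
      then have "(norm p)\<^sup>2 \<le> (1 / B\<^sup>2) * (norm (?S *v p))\<^sup>2"
        using B(1) by (simp add: power_mult_distrib field_simps)
      then have "(norm (?j p))\<^sup>2 \<le> (1 / B\<^sup>2 + 1) * (norm (?S *v p))\<^sup>2"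
        by (simp add: norm_vjoin distrib_right)
      then have "e * (norm (?j p))\<^sup>2 \<le> e * ((1 / B\<^sup>2 + 1) * (norm (?S *v p))\<^sup>2)"
        using k by (intro mult_left_mono) (auto simp: e_def)
      also have "\<dots> = 2 * (norm (?S *v p))\<^sup>2" using k by (simp add: e_def)
      finally have "t * (e * (norm (?j p))\<^sup>2) \<le> t * (2 * (norm (?S *v p))\<^sup>2)"
        using t by (rule mult_left_mono)
      also have "\<dots> \<le> qform (T_block A l t) (?j p)"
        by (simp add: qform_T_block[OF l] qform_G[OF l] cip_self)
      finally show ?thesis by (simp add: ac_simps)
    qed
    with ind show "plane_bound (T_block A l t) (e * t)"
      unfolding plane_bound_def by (intro exI[of _ "?j ?p"] exI[of _ "?j ?q"]) (simp only: comb simp_thms)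
  qed
  moreover have "0 < e" using k by (simp add: e_def)
  ultimately show thesis using that by blast
qed

lemma T_attains_min:
  fixes A :: "complex^'n^'n"
  assumes l: "l \<noteq> 0" and inv: "invertible (pencil A (star_mat Star_T A) l)"
  shows "\<exists>m. is_minimum m {lambda_2 (T_block A l t) | t. 0 \<le> t}"
  using S_zero_or_injective[OF l inv]
proof
  define c where "c = lambda_2 (T_block A l 0)"
  assume "S_mat A l = 0"
  then have const: "lambda_2 (T_block A l t) = c" for t unfolding c_def
    by (simp add: T_block_def Let_def conj_mat_def map_matrix_def flip: zero_vec_def)
  then show ?thesis unfolding is_minimum_def
    by (intro exI[of _ c]) (auto simp: const)
next
  assume "\<forall>z. S_mat A l *v z = 0 \<longrightarrow> z = 0"
  then obtain e where e: "0 < e" "\<And>t. 0 \<le> t \<Longrightarrow> e * t \<le> lambda_2 (T_block A l t)"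
    using T_coercive[OF l] by metis
  define T1 where "T1 = block_mat 0 (conj_mat (S_mat A l)) (S_mat A l) 0"
  have "T_block A l t *v z = (T_block A l 0 + t *\<^sub>R T1) *v z" for t z
    by (cases z rule: vjoin_cases)
      (simp add: T_block_vjoin T1_def matrix_vector_mult_add_rdistrib matrix_scaleR_left
        block_mat_vjoin vjoin_add scaleR_eq_smult vjoin_smult add.commute)
  then have T: "T_block A l t = T_block A l 0 + t *\<^sub>R T1" for t by (simp add: matrix_eq)
  have cont: "continuous_on {0..} (T_block A l)"
    by (subst fun_eq_iff[THEN iffD2, OF allI, OF T]) (intro continuous_intros)
  have "continuous_on {0..} (\<lambda>t. lambda_2 (T_block A l t))"
    by (rule continuous_on_compose2[OF continuous_on_lambda_2[of "Inl (Inl undefined)" "Inr (Inl undefined)"] cont])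
      (auto simp: hermitian_T_block[OF l])
  moreover have "e * norm t \<le> lambda_2 (T_block A l t)" if "t \<in> {0..}" for t
    using e(2)[of t] that by simp
  ultimately obtain t where t: "0 \<le> t"
      "\<And>s. 0 \<le> s \<Longrightarrow> lambda_2 (T_block A l t) \<le> lambda_2 (T_block A l s)"
    using coercive_attains_min[of "{0::real..}" 0 "\<lambda>t. lambda_2 (T_block A l t)" e] e(1) by auto
  have "is_minimum (lambda_2 (T_block A l t)) {lambda_2 (T_block A l t) | t. 0 \<le> t}"
    unfolding is_minimum_def
  proof
    show "lambda_2 (T_block A l t) \<in> {lambda_2 (T_block A l t) | t. 0 \<le> t}" using t(1) by blast
  qed (use t(2) in auto)
  then show ?thesis ..
qed

section \<open>The lower bounds for the distance\<close>

text \<open>The part of the argument common to both stars; \<open>X j\<close> stands for the set of values of the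
  function to be minimised. Every value gives a bound for the distance; the minimum gives the
  best one.\<close>

lemma pal_dist_ge_minima:
  assumes J: "finite J" "J \<noteq> {}"
    and attained: "\<And>j. j \<in> J \<Longrightarrow> \<exists>m. is_minimum m (X j)"
    and pos: "\<And>j v. j \<in> J \<Longrightarrow> v \<in> X j \<Longrightarrow> 0 < v"
    and bound: "\<And>j v D. j \<in> J \<Longrightarrow> v \<in> X j \<Longrightarrow>
      \<forall>s. det (pencil (A - D) (star_mat st A - star_mat st D) s) = 0 \<Longrightarrow>
      1 \<le> v * (spectral_norm D)\<^sup>2"
  shows "\<exists>m. (\<forall>j\<in>J. 0 < m j \<and> is_minimum (m j) (X j)) \<and>
    (pal_dist st A)\<^sup>2 \<ge> 2 * (MAX j\<in>J. inverse (m j))"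
proof -
  have "\<exists>m. \<forall>j\<in>J. is_minimum (m j) (X j)" using attained by (intro bchoice) blast
  then obtain m where m: "\<forall>j\<in>J. is_minimum (m j) (X j)" ..
  then have mem: "m j \<in> X j" if "j \<in> J" for j using that by (simp add: is_minimum_def)
  have "(MAX j\<in>J. inverse (m j)) \<in> (\<lambda>j. inverse (m j)) ` J"
    using J by (intro Max_in) auto
  then obtain j where j: "j \<in> J" "(MAX j\<in>J. inverse (m j)) = inverse (m j)" by blast
  have "2 * inverse (m j) \<le> (pal_dist st A)\<^sup>2"
    using pos[OF j(1) mem[OF j(1)]] bound[OF j(1) mem[OF j(1)]] by (rule pal_dist_ge)
  with j(2) m mem pos show ?thesis by (intro exI[of _ m]) auto
qed

theorem theorem5p6:
  fixes A :: "complex^'n^'n" and lam :: "nat \<Rightarrow> complex" and st :: star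
  assumes "regular_pencil A (star_mat st A)"
    and "lam \<in> \<K> (pencil A (star_mat st A))"
    and "\<forall>j \<in> {1..CARD('n) + 1}. lam j \<noteq> 0"
  shows "(st = Star_CT \<longrightarrow>
           (\<exists>m. (\<forall>j \<in> {1..CARD('n) + 1}. 0 < m j \<and>
                   is_minimum (m j)
                     {lambda_max (G_mat Star_CT A (lam j)
                        + t1 *\<^sub>R H1_mat A (lam j) + t2 *\<^sub>R H2_mat A (lam j)) | t1 t2. True})
              \<and> (pal_dist Star_CT A)\<^sup>2 \<ge> 2 * (MAX j \<in> {1..CARD('n) + 1}. inverse (m j))))
       \<and> (st = Star_T \<longrightarrow>
           (\<exists>m. (\<forall>j \<in> {1..CARD('n) + 1}. 0 < m j \<and>
                   is_minimum (m j) {lambda_2 (T_block A (lam j) t) | t. 0 \<le> t})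
              \<and> (pal_dist Star_T A)\<^sup>2 \<ge> 2 * (MAX j \<in> {1..CARD('n) + 1}. inverse (m j))))"
proof (intro conjI impI)
  assume CT: "st = Star_CT"
  show "\<exists>m. (\<forall>j \<in> {1..CARD('n) + 1}. 0 < m j \<and>
                   is_minimum (m j)
                     {lambda_max (G_mat Star_CT A (lam j)
                        + t1 *\<^sub>R H1_mat A (lam j) + t2 *\<^sub>R H2_mat A (lam j)) | t1 t2. True})
              \<and> (pal_dist Star_CT A)\<^sup>2 \<ge> 2 * (MAX j \<in> {1..CARD('n) + 1}. inverse (m j))"
  proof (rule pal_dist_ge_minima)
    fix j assume "j \<in> {1..CARD('n) + 1}"
    then have lam: "lam j \<noteq> 0" "invertible (pencil A (star_mat Star_CT A) (lam j))"
      using assms(2,3) by (auto simp: CT \<K>_def)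
    let ?X = "{lambda_max (G_mat Star_CT A (lam j)
      + t1 *\<^sub>R H1_mat A (lam j) + t2 *\<^sub>R H2_mat A (lam j)) | t1 t2. True}"
    show "\<exists>m. is_minimum m ?X" by (rule CT_attains_min[OF lam])
    show "0 < v" if "v \<in> ?X" for v
      using that CT_bound(1)[OF lam singular_self] by blast
    show "1 \<le> v * (spectral_norm D)\<^sup>2"
      if "v \<in> ?X" "\<forall>s. det (pencil (A - D) (star_mat Star_CT A - star_mat Star_CT D) s) = 0" for v D
      using that(1) CT_bound(2)[OF lam that(2)[rule_format]] by blast
  qed simp_all
next
  assume T: "st = Star_T"
  show "\<exists>m. (\<forall>j \<in> {1..CARD('n) + 1}. 0 < m j \<and>
                   is_minimum (m j) {lambda_2 (T_block A (lam j) t) | t. 0 \<le> t})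
              \<and> (pal_dist Star_T A)\<^sup>2 \<ge> 2 * (MAX j \<in> {1..CARD('n) + 1}. inverse (m j))"
  proof (rule pal_dist_ge_minima)
    fix j assume "j \<in> {1..CARD('n) + 1}"
    then have lam: "lam j \<noteq> 0" "invertible (pencil A (star_mat Star_T A) (lam j))"
      using assms(2,3) by (auto simp: T \<K>_def)
    let ?X = "{lambda_2 (T_block A (lam j) t) | t. 0 \<le> t}"
    show "\<exists>m. is_minimum m ?X" by (rule T_attains_min[OF lam])
    show "0 < v" if "v \<in> ?X" for v
      using that T_bound(1)[OF lam singular_self] by blast
    show "1 \<le> v * (spectral_norm D)\<^sup>2"
      if "v \<in> ?X" "\<forall>s. det (pencil (A - D) (star_mat Star_T A - star_mat Star_T D) s) = 0" for v D
      using that(1) T_bound(2)[OF lam that(2)[rule_format]] by blast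
  qed simp_all
qed

end
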